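(* Exact self-embezzlement is possible in the commuting-operator model: there exist a Hilbert space $\mathcal{H}$; unital C*-subalgebras $\mathcal{A}_1,\mathcal{B}_1,\mathcal{A}_2,\mathcal{B}_2\subseteq B(\mathcal{H})$ that pairwise commute (the algebras of registers $\mathsf{A}_1,\mathsf{B}_1,\mathsf{A}_2,\mathsf{B}_2$); a unit vector $\psi\in\mathcal{H}$; a unitary $U_A$ acting on register $(\mathsf{A}_1,\mathsf{A}_2)$ and a unitary $U_B$ acting on register $(\mathsf{B}_1,\mathsf{B}_2)$ with $U_AU_B=U_BU_A$; such that, with $\psi'=U_AU_B\psi$: (0) the state of $(\mathsf{A}_1,\mathsf{B}_1)$ maximally violates CHSH: there exist self-adjoint $a_0,a_1\in\mathcal{A}_1$, $b_0,b_1\in\mathcal{B}_1$ of norm at most $1$ with $\langle\psi,(a_0b_0+a_0b_1+a_1b_0-a_1b_1)\psi\rangle=2\sqrt2$; (1) $\psi$ is a product state over $(\mathsf{A}_1,\mathsf{B}_1)$, $\mathsf{A}_2$, $\mathsf{B}_2$: for all $X\in\overline{\mathcal{A}_1\cup\mathcal{B}_1}$, $Y\in\mathcal{A}_2$, $Z\in\mathcal{B}_2$, $\langle\psi,XYZ\psi\rangle=\langle\psi,X\psi\rangle\langle\psi,Y\psi\rangle\langle\psi,Z\psi\rangle$; (2) register $(\mathsf{A}_1,\mathsf{B}_1)$ is unchanged: $\langle\psi,X\psi\rangle=\langle\psi',X\psi'\rangle$ for all $X\in\overline{\mathcal{A}_1\cup\mathcal{B}_1}$; (3) there exist unitaries $W_A$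 acting on register $(\mathsf{A}_1,\mathsf{A}_2)$ and $W_B$ acting on register $(\mathsf{B}_1,\mathsf{B}_2)$ with $W_A^*\mathcal{A}_1W_A=\mathcal{A}_2$, $W_B^*\mathcal{B}_1W_B=\mathcal{B}_2$, and $\langle\psi',XY\psi'\rangle=\langle\psi',(W_A^*XW_A)(W_B^*YW_B)\psi'\rangle$ for all $X\in\mathcal{A}_1$, $Y\in\mathcal{B}_1$.
   Context: For a compound register $(\mathsf{R}_{k_1},\dots,\mathsf{R}_{k_\ell})$ among registers with pairwise commuting algebras $\mathcal{A}_1,\dots,\mathcal{A}_m\subseteq B(\mathcal{H})$, its algebra is $\mathcal{A}_{(k_1,\dots,k_\ell)}=\overline{\mathcal{A}_{k_1}\cup\cdots\cup\mathcal{A}_{k_\ell}}$, the C*-algebra generated by these. A unitary $U\in B(\mathcal{H})$ acts on register $(\mathsf{R}_{k_1},\dots,\mathsf{R}_{k_\ell})$ if (i) $U^*AU=A$ for every $A\in\mathcal{A}_j$ with $j\notin\{k_1,\dots,k_\ell\}$, and (ii) $U^*\mathcal{A}_{(k_1,\dots,k_\ell)}U=\mathcal{A}_{(k_1,\dots,k_\ell)}$. Here the four registers are $\mathsf{A}_1,\mathsf{B}_1,\mathsf{A}_2,\mathsf{B}_2$ with algebras $\mathcal{A}_1,\mathcal{B}_1,\mathcal{A}_2,\mathcal{B}_2$. *)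

theory Defs
  imports Complex_Main
begin

text \<open>The Hilbert space is the complex sequence space l2(nat) (the separable
infinite-dimensional complex Hilbert space).  Vectors are functions nat to complex;
l2 is the carrier.  Inner product is linear in the second argument.\<close>

type_synonym vec = "nat \<Rightarrow> complex"
type_synonym op = "vec \<Rightarrow> vec"

definition l2 :: "vec set" where
  "l2 = {x. summable (\<lambda>n. (cmod (x n))\<^sup>2)}"

definition hinner :: "vec \<Rightarrow> vec \<Rightarrow> complex" where
  "hinner x y = (\<Sum>n. cnj (x n) * y n)"

definition hnorm :: "vec \<Rightarrow> real" where
  "hnorm x = sqrt (\<Sum>n. (cmod (x n))\<^sup>2)"

text \<open>Bounded operators on l2, normalised to be 0 outside l2 so that
function equality is operator equality.\<close>
definition bop :: "op \<Rightarrow> bool" where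
  "bop T \<longleftrightarrow>
     (\<forall>x\<in>l2. T x \<in> l2) \<and>
     (\<forall>x\<in>l2. \<forall>y\<in>l2. T (\<lambda>n. x n + y n) = (\<lambda>n. T x n + T y n)) \<and>
     (\<forall>x\<in>l2. \<forall>c. T (\<lambda>n. c * x n) = (\<lambda>n. c * T x n)) \<and>
     (\<exists>C. \<forall>x\<in>l2. hnorm (T x) \<le> C * hnorm x) \<and>
     (\<forall>x. x \<notin> l2 \<longrightarrow> T x = (\<lambda>n. 0))"

definition idop :: op where
  "idop x = (if x \<in> l2 then x else (\<lambda>n. 0))"

definition opadd :: "op \<Rightarrow> op \<Rightarrow> op" where
  "opadd S T = (\<lambda>x n. S x n + T x n)"

definition opscale :: "complex \<Rightarrow> op \<Rightarrow> op" where
  "opscale c T = (\<lambda>x n. c * T x n)"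

definition opminus :: "op \<Rightarrow> op \<Rightarrow> op" where
  "opminus S T = (\<lambda>x n. S x n - T x n)"

definition opnorm :: "op \<Rightarrow> real" where
  "opnorm T = Sup {hnorm (T x) | x. x \<in> l2 \<and> hnorm x \<le> 1}"

definition adj :: "op \<Rightarrow> op" where
  "adj T = (\<lambda>y. if y \<in> l2
              then (THE z. z \<in> l2 \<and> (\<forall>x\<in>l2. hinner z x = hinner y (T x)))
              else (\<lambda>n. 0))"

definition unitary :: "op \<Rightarrow> bool" where
  "unitary U \<longleftrightarrow> bop U \<and> U \<circ> adj U = idop \<and> adj U \<circ> U = idop"

definition unital_cstar_subalg :: "op set \<Rightarrow> bool" where
  "unital_cstar_subalg A \<longleftrightarrow>
     (\<forall>T\<in>A. bop T) \<and> idop \<in> A \<and>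
     (\<forall>S\<in>A. \<forall>T\<in>A. opadd S T \<in> A) \<and>
     (\<forall>c. \<forall>T\<in>A. opscale c T \<in> A) \<and>
     (\<forall>S\<in>A. \<forall>T\<in>A. S \<circ> T \<in> A) \<and>
     (\<forall>T\<in>A. adj T \<in> A) \<and>
     (\<forall>f T. (\<forall>k. f k \<in> A) \<and> bop T \<and> (\<lambda>k. opnorm (opminus (f k) T)) \<longlonglongrightarrow> 0
            \<longrightarrow> T \<in> A)"

definition cstar_gen :: "op set \<Rightarrow> op set" where
  "cstar_gen S = \<Inter>{B. unital_cstar_subalg B \<and> S \<subseteq> B}"

definition commute_algs :: "op set \<Rightarrow> op set \<Rightarrow> bool" where
  "commute_algs A B \<longleftrightarrow> (\<forall>a\<in>A. \<forall>b\<in>B. a \<circ> b = b \<circ> a)"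

definition conjop :: "op \<Rightarrow> op \<Rightarrow> op" where
  "conjop U A = adj U \<circ> A \<circ> U"

definition acts_on :: "op \<Rightarrow> op set set \<Rightarrow> op set set \<Rightarrow> bool" where
  "acts_on U Others Reg \<longleftrightarrow>
     (\<forall>Al\<in>Others. \<forall>A\<in>Al. conjop U A = A) \<and>
     conjop U ` cstar_gen (\<Union>Reg) = cstar_gen (\<Union>Reg)"

end

theory Submission
  imports Defs "HOL-Analysis.L2_Norm" "HOL-Library.Countable_Set"
begin

text \<open>Both parties own infinitely many qubits, the sites i in nat: register 1 consists of the even
sites, register 2 of the odd ones. Initially the A- and B-qubits of site i form a maximally entangled
pair if 4 divides i, and all other qubits are independent and maximally mixed. A permutation of the
sites, applied by both parties, maps the multiples of 4 together with their odd neighbours onto the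
multiples of 4; afterwards the even sites look as before and the odd sites are a copy of them.

Permuting the A-qubits only is not implementable in the representation defined by the initial
state. So take the direct sum of its twists by all pairs (f, k) from a countable group of site
permutations, f acting on the A-qubits and k on the B-qubits: now permuting the A-qubits just
relabels the summands, and this commutes with every operator of B. All Pauli operators are signed
permutations of a countable basis, and every claim about the generated algebras follows because
commutants of bounded operators are C*-algebras.\<close>

section \<open>Square-summable sequences\<close>

text \<open>The obstacle: a unitary moving only the A-qubits in the initial representation would
  carry the correlations X_A X_B of infinitely many pairs to products over different slots, and
  their averages would have to tend to 1 and to 0 at once. In the normalised Hilbert-Schmidt product
  the identity of a slot is a unit vector, and its vector state is the normalised trace for left and
  right multiplication alike. So a slot used by one party holds a maximally mixed qubit, and on a
  shared slot <1, L_a R_b 1> = tr(ab)/2 is the correlation of a maximally entangled pair. In the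
  summand (g, g) the empty label is the state in which site i plays the role of g i, entangled
  exactly if 4 divides g i. Conditions (2) and (3) therefore only ask for a bijection g such that,
  for even i, 4 divides all or none of i, g i and g (i + 1). Infinitely many pairs make room for it,
  as in Hilbert's hotel. Off-diagonal summands are present because U_A alone leaves the diagonal;
  the group and the labels must be countable because the Hilbert space is l2(nat).\<close>

abbreviation (input) vadd :: "vec \<Rightarrow> vec \<Rightarrow> vec" where "vadd x y \<equiv> \<lambda>n. x n + y n"
abbreviation (input) vscale :: "complex \<Rightarrow> vec \<Rightarrow> vec" where "vscale c x \<equiv> \<lambda>n. c * x n"

definition unitvec :: "nat \<Rightarrow> vec" where
  "unitvec k = (\<lambda>n. if n = k then 1 else 0)"

lemma l2_summable: "x \<in> l2 \<Longrightarrow> summable (\<lambda>n. (cmod (x n))\<^sup>2)"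
  by (simp add: l2_def)

lemma cmod_mult_le: "cmod (cnj a * b) \<le> (cmod a)\<^sup>2 + (cmod b)\<^sup>2"
proof -
  have "0 \<le> (cmod a - cmod b)\<^sup>2" by simp
  then have "2 * (cmod a * cmod b) \<le> (cmod a)\<^sup>2 + (cmod b)\<^sup>2"
    by (simp add: power2_diff)
  moreover have "0 \<le> cmod a * cmod b" by simp
  ultimately have "cmod a * cmod b \<le> (cmod a)\<^sup>2 + (cmod b)\<^sup>2" by linarith
  then show ?thesis by (simp add: norm_mult)
qed

lemma summable_norm_hinner:
  assumes "x \<in> l2" "y \<in> l2"
  shows "summable (\<lambda>n. cmod (cnj (x n) * y n))"
  by (rule summable_comparison_test'[OF summable_add[OF l2_summable[OF assms(1)] l2_summable[OF assms(2)]]])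
     (use cmod_mult_le in auto)

lemma summable_hinner: "x \<in> l2 \<Longrightarrow> y \<in> l2 \<Longrightarrow> summable (\<lambda>n. cnj (x n) * y n)"
  by (rule summable_norm_cancel) (rule summable_norm_hinner)

lemma l2_scale [intro]: "x \<in> l2 \<Longrightarrow> vscale c x \<in> l2"
  unfolding l2_def by (simp add: norm_mult power_mult_distrib summable_mult)

lemma cmod_add_sq: "(cmod (a + b))\<^sup>2 \<le> 2 * (cmod a)\<^sup>2 + 2 * (cmod b)\<^sup>2"
proof -
  have "(cmod (a + b))\<^sup>2 \<le> (cmod a + cmod b)\<^sup>2"
    by (intro power_mono norm_triangle_ineq) auto
  also have "\<dots> \<le> 2 * (cmod a)\<^sup>2 + 2 * (cmod b)\<^sup>2"
    using zero_le_power2[of "cmod a - cmod b"] by (simp add: power2_sum power2_diff)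
  finally show ?thesis .
qed

lemma l2_add [intro]:
  assumes "x \<in> l2" "y \<in> l2" shows "vadd x y \<in> l2"
proof -
  have "summable (\<lambda>n. 2 * (cmod (x n))\<^sup>2 + 2 * (cmod (y n))\<^sup>2)"
    using assms by (intro summable_add summable_mult l2_summable)
  then show ?thesis
    unfolding l2_def mem_Collect_eq
    by (rule summable_comparison_test') (use cmod_add_sq in auto)
qed

lemma l2_diff [intro]: "x \<in> l2 \<Longrightarrow> y \<in> l2 \<Longrightarrow> (\<lambda>n. x n - y n) \<in> l2"
  using l2_add[of x "vscale (-1) y"] l2_scale[of y "-1"] by simp

lemma l2_zero [simp]: "(\<lambda>n. 0) \<in> l2" by (simp add: l2_def)

lemma l2_finite_support:
  assumes "finite F" "\<And>n. n \<notin> F \<Longrightarrow> x n = 0" shows "x \<in> l2"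
  unfolding l2_def using assms by (auto intro!: summable_finite[of F])

lemma unitvec_l2 [simp]: "unitvec k \<in> l2"
  by (rule l2_finite_support[of "{k}"]) (auto simp: unitvec_def)

lemma hinner_add_right:
  "x \<in> l2 \<Longrightarrow> y \<in> l2 \<Longrightarrow> z \<in> l2 \<Longrightarrow> hinner x (vadd y z) = hinner x y + hinner x z"
  unfolding hinner_def by (simp add: distrib_left suminf_add[symmetric] summable_hinner)

lemma hinner_scale_right:
  "x \<in> l2 \<Longrightarrow> y \<in> l2 \<Longrightarrow> hinner x (vscale c y) = c * hinner x y"
  unfolding hinner_def using suminf_mult[OF summable_hinner, of x y c]
  by (simp add: mult.left_commute)

lemma hinner_diff_right:
  assumes "x \<in> l2" "y \<in> l2" "z \<in> l2"
  shows "hinner x (\<lambda>n. y n - z n) = hinner x y - hinner x z"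
  using hinner_add_right[OF assms(1,2) l2_scale[OF assms(3), of "-1"]]
    hinner_scale_right[OF assms(1,3), of "-1"] by simp

lemma hinner_cnj: "x \<in> l2 \<Longrightarrow> y \<in> l2 \<Longrightarrow> cnj (hinner x y) = hinner y x"
  unfolding hinner_def using sums_cnj[THEN iffD2, OF summable_sums, OF summable_hinner, of x y]
  by (simp add: sums_iff mult.commute)

lemma hinner_unitvec_left [simp]: "hinner (unitvec k) y = y k"
proof -
  have "(\<lambda>n. cnj (unitvec k n) * y n) = (\<lambda>n. if n = k then y n else 0)"
    by (auto simp: unitvec_def)
  then show ?thesis
    using sums_unique[OF sums_single[of k y]] by (simp add: hinner_def)
qed

lemma hinner_self: "x \<in> l2 \<Longrightarrow> hinner x x = complex_of_real ((hnorm x)\<^sup>2)"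
proof -
  assume "x \<in> l2"
  have "(\<lambda>n. cnj (x n) * x n) = (\<lambda>n. complex_of_real ((cmod (x n))\<^sup>2))"
    by (rule ext) (metis complex_norm_square mult.commute)
  then have "hinner x x = complex_of_real (\<Sum>n. (cmod (x n))\<^sup>2)"
    unfolding hinner_def using suminf_of_real[OF l2_summable[OF \<open>x \<in> l2\<close>], where 'a=complex] by argo
  moreover have "0 \<le> (\<Sum>n. (cmod (x n))\<^sup>2)"
    using \<open>x \<in> l2\<close> by (intro suminf_nonneg l2_summable) auto
  ultimately show ?thesis
    unfolding hnorm_def by (simp only: real_sqrt_pow2)
qed

lemma hnorm_nonneg [simp]: "x \<in> l2 \<Longrightarrow> 0 \<le> hnorm x"
  unfolding hnorm_def by (intro real_sqrt_ge_zero suminf_nonneg l2_summable) auto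

lemma hnorm_coord_le: "x \<in> l2 \<Longrightarrow> cmod (x k) \<le> hnorm x"
proof -
  assume x: "x \<in> l2"
  have "(\<Sum>n\<in>{k}. (cmod (x n))\<^sup>2) \<le> (\<Sum>n. (cmod (x n))\<^sup>2)"
    by (rule sum_le_suminf) (use x l2_summable in auto)
  then show ?thesis unfolding hnorm_def by (simp add: real_le_rsqrt)
qed

lemma hnorm_scale: "x \<in> l2 \<Longrightarrow> hnorm (vscale c x) = cmod c * hnorm x"
  unfolding hnorm_def
  by (simp add: norm_mult power_mult_distrib suminf_mult l2_summable real_sqrt_mult)

lemma sum_L2_le_hnorm: "x \<in> l2 \<Longrightarrow> L2_set (\<lambda>n. cmod (x n)) {..<N} \<le> hnorm x"
  unfolding hnorm_def L2_set_def
  by (intro real_sqrt_le_mono sum_le_suminf) (auto intro: l2_summable)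

lemma hinner_Cauchy_Schwarz:
  assumes "x \<in> l2" "y \<in> l2"
  shows "cmod (hinner x y) \<le> hnorm x * hnorm y"
proof -
  have "cmod (hinner x y) \<le> (\<Sum>n. cmod (cnj (x n) * y n))"
    unfolding hinner_def by (rule summable_norm[OF summable_norm_hinner[OF assms]])
  also have "\<dots> \<le> hnorm x * hnorm y"
  proof (rule suminf_le_const[OF summable_norm_hinner[OF assms]])
    fix N
    have "(\<Sum>n<N. cmod (cnj (x n) * y n)) = (\<Sum>n<N. \<bar>cmod (x n)\<bar> * \<bar>cmod (y n)\<bar>)"
      by (simp add: norm_mult)
    also have "\<dots> \<le> L2_set (\<lambda>n. cmod (x n)) {..<N} * L2_set (\<lambda>n. cmod (y n)) {..<N}"
      by (rule L2_set_mult_ineq)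
    also have "\<dots> \<le> hnorm x * hnorm y"
      by (intro mult_mono sum_L2_le_hnorm assms hnorm_nonneg) auto
    finally show "(\<Sum>n<N. cmod (cnj (x n) * y n)) \<le> hnorm x * hnorm y" .
  qed
  finally show ?thesis .
qed

lemma hnorm_triangle:
  assumes "x \<in> l2" "y \<in> l2" shows "hnorm (vadd x y) \<le> hnorm x + hnorm y"
proof -
  have xy: "vadd x y \<in> l2" using assms by auto
  have "hinner (vadd x y) (vadd x y) = hinner (vadd x y) x + hinner (vadd x y) y"
    using assms xy by (simp add: hinner_add_right)
  then have "(hnorm (vadd x y))\<^sup>2 = cmod (hinner (vadd x y) x + hinner (vadd x y) y)"
    using hinner_self[OF xy] by (metis norm_of_real abs_power2)
  also have "\<dots> \<le> cmod (hinner (vadd x y) x) + cmod (hinner (vadd x y) y)"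
    by (rule norm_triangle_ineq)
  also have "\<dots> \<le> hnorm (vadd x y) * hnorm x + hnorm (vadd x y) * hnorm y"
    by (intro add_mono hinner_Cauchy_Schwarz xy assms)
  finally have "hnorm (vadd x y) * hnorm (vadd x y) \<le> hnorm (vadd x y) * (hnorm x + hnorm y)"
    by (simp only: power2_eq_square distrib_left)
  then have "hnorm (vadd x y) \<le> 0 \<or> hnorm (vadd x y) \<le> hnorm x + hnorm y"
    by (metis linorder_not_le mult_le_cancel_left_pos)
  then show ?thesis
    using hnorm_nonneg[OF assms(1)] hnorm_nonneg[OF assms(2)] by linarith
qed

section \<open>Bounded operators and the Riesz representation\<close>

lemma null_seq_comparison:
  fixes f :: "nat \<Rightarrow> complex"
  assumes "g \<longlonglongrightarrow> (0::real)" "\<And>k. cmod (f k) \<le> g k"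
  shows "f \<longlonglongrightarrow> 0"
proof (rule tendsto_0_le[OF assms(1), of _ 1])
  have "cmod (f k) \<le> norm (g k) * 1" for k
    using assms(2)[of k] by simp
  then show "\<forall>\<^sub>F k in sequentially. cmod (f k) \<le> norm (g k) * 1" by simp
qed

lemma bopI:
  assumes "\<And>x. x \<in> l2 \<Longrightarrow> T x \<in> l2"
    and "\<And>x y. x \<in> l2 \<Longrightarrow> y \<in> l2 \<Longrightarrow> T (vadd x y) = vadd (T x) (T y)"
    and "\<And>x c. x \<in> l2 \<Longrightarrow> T (vscale c x) = vscale c (T x)"
    and "\<And>x. x \<in> l2 \<Longrightarrow> hnorm (T x) \<le> C * hnorm x"
    and "\<And>x. x \<notin> l2 \<Longrightarrow> T x = (\<lambda>n. 0)"
  shows "bop T"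
  unfolding bop_def by (intro conjI ballI allI impI exI[of _ C] assms)

lemma bop_l2: "bop T \<Longrightarrow> T x \<in> l2"
  unfolding bop_def by (cases "x \<in> l2") auto

lemma bop_add: "bop T \<Longrightarrow> x \<in> l2 \<Longrightarrow> y \<in> l2 \<Longrightarrow> T (vadd x y) = vadd (T x) (T y)"
  unfolding bop_def by simp

lemma bop_scale: "bop T \<Longrightarrow> x \<in> l2 \<Longrightarrow> T (vscale c x) = vscale c (T x)"
  unfolding bop_def by simp

lemma bop_outside: "bop T \<Longrightarrow> x \<notin> l2 \<Longrightarrow> T x = (\<lambda>n. 0)"
  unfolding bop_def by simp

lemma bop_zero: "bop T \<Longrightarrow> T (\<lambda>n. 0) = (\<lambda>n. 0)"
  using bop_scale[of T "\<lambda>n. 0" 0] by simp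

lemma bop_bounded:
  assumes "bop T"
  obtains C where "0 \<le> C" "\<And>x. x \<in> l2 \<Longrightarrow> hnorm (T x) \<le> C * hnorm x"
proof -
  have "\<exists>C. \<forall>x\<in>l2. hnorm (T x) \<le> C * hnorm x"
    using assms by (simp add: bop_def)
  then obtain C where C: "\<And>x. x \<in> l2 \<Longrightarrow> hnorm (T x) \<le> C * hnorm x"
    by auto
  have "hnorm (T x) \<le> \<bar>C\<bar> * hnorm x" if "x \<in> l2" for x
    using C[OF that] hnorm_nonneg[OF that] by (meson abs_ge_self mult_right_mono order_trans)
  then show ?thesis using that[of "\<bar>C\<bar>"] by simp
qed

lemma bop_eqI:
  assumes "bop S" "bop T" "\<And>x. x \<in> l2 \<Longrightarrow> S x = T x" shows "S = T"
proof
  show "S x = T x" for x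
    using assms(3) bop_outside[OF assms(1)] bop_outside[OF assms(2)] by (cases "x \<in> l2") simp_all
qed

lemma bop_eqI_hinner:
  assumes "bop S" "bop T"
    and "\<And>x y. x \<in> l2 \<Longrightarrow> y \<in> l2 \<Longrightarrow> hinner y (S x) = hinner y (T x)"
  shows "S = T"
proof (rule bop_eqI[OF assms(1,2)], rule ext)
  fix x n assume "x \<in> l2"
  then show "S x n = T x n" using assms(3)[of x "unitvec n"] by simp
qed

lemma bop_comp: assumes "bop S" "bop T" shows "bop (S \<circ> T)"
proof -
  obtain C where C: "0 \<le> C" "\<And>x. x \<in> l2 \<Longrightarrow> hnorm (S x) \<le> C * hnorm x"
    using bop_bounded[OF assms(1)] by blast
  obtain D where D: "0 \<le> D" "\<And>x. x \<in> l2 \<Longrightarrow> hnorm (T x) \<le> D * hnorm x"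
    using bop_bounded[OF assms(2)] by blast
  show ?thesis
  proof (rule bopI[where C = "C * D"])
    fix x assume "x \<in> l2"
    then have "hnorm (S (T x)) \<le> C * hnorm (T x)" "C * hnorm (T x) \<le> C * (D * hnorm x)"
      using C D bop_l2[OF assms(2)] by (auto intro: mult_left_mono)
    then show "hnorm ((S \<circ> T) x) \<le> C * D * hnorm x" by (simp add: mult.assoc)
  qed (use assms bop_l2 bop_add bop_scale bop_outside bop_zero in auto)
qed

lemma bop_opadd: assumes "bop S" "bop T" shows "bop (opadd S T)"
proof -
  obtain C where C: "0 \<le> C" "\<And>x. x \<in> l2 \<Longrightarrow> hnorm (S x) \<le> C * hnorm x"
    using bop_bounded[OF assms(1)] by blast
  obtain D where D: "0 \<le> D" "\<And>x. x \<in> l2 \<Longrightarrow> hnorm (T x) \<le> D * hnorm x"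
    using bop_bounded[OF assms(2)] by blast
  show ?thesis
  proof (rule bopI[where C = "C + D"])
    fix x assume "x \<in> l2"
    then have "hnorm (opadd S T x) \<le> hnorm (S x) + hnorm (T x)"
      unfolding opadd_def using assms bop_l2 by (intro hnorm_triangle) auto
    also have "\<dots> \<le> C * hnorm x + D * hnorm x"
      using C D \<open>x \<in> l2\<close> by (intro add_mono) auto
    finally show "hnorm (opadd S T x) \<le> (C + D) * hnorm x" by (simp add: distrib_right)
  qed (use assms in \<open>auto simp: opadd_def bop_l2 bop_add bop_scale bop_outside algebra_simps intro!: l2_add\<close>)
qed

lemma bop_opscale: assumes "bop T" shows "bop (opscale c T)"
proof -
  obtain D where D: "0 \<le> D" "\<And>x. x \<in> l2 \<Longrightarrow> hnorm (T x) \<le> D * hnorm x"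
    using bop_bounded[OF assms(1)] by blast
  show ?thesis
  proof (rule bopI[where C = "cmod c * D"])
    fix x assume "x \<in> l2"
    then show "hnorm (opscale c T x) \<le> cmod c * D * hnorm x"
      using hnorm_scale[of "T x" c] bop_l2[OF assms] D(2)[of x]
      by (simp add: opscale_def mult.assoc mult_left_mono)
  qed (use assms in \<open>auto simp: opscale_def bop_l2 bop_add bop_scale bop_outside algebra_simps intro!: l2_scale\<close>)
qed

lemma opminus_eq: "opminus S T = opadd S (opscale (-1) T)"
  by (simp add: opminus_def opadd_def opscale_def)

lemma bop_opminus: "bop S \<Longrightarrow> bop T \<Longrightarrow> bop (opminus S T)"
  by (simp add: opminus_eq bop_opadd bop_opscale)

lemma bop_idop [simp]: "bop idop"
  by (rule bopI[where C = 1]) (auto simp: idop_def)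

lemma idop_comp [simp]: "bop T \<Longrightarrow> idop \<circ> T = T" "bop T \<Longrightarrow> T \<circ> idop = T"
  by (auto simp: idop_def fun_eq_iff bop_l2 bop_outside bop_zero)

lemma opadd_comp: "opadd S T \<circ> R = opadd (S \<circ> R) (T \<circ> R)"
  by (auto simp: opadd_def)

lemma comp_opadd: "bop R \<Longrightarrow> bop S \<Longrightarrow> bop T \<Longrightarrow> R \<circ> opadd S T = opadd (R \<circ> S) (R \<circ> T)"
  by (auto simp: opadd_def bop_add bop_l2)

lemma opscale_comp: "opscale c T \<circ> R = opscale c (T \<circ> R)"
  by (auto simp: opscale_def)

lemma comp_opscale: "bop R \<Longrightarrow> bop T \<Longrightarrow> R \<circ> opscale c T = opscale c (R \<circ> T)"
  by (auto simp: opscale_def bop_scale bop_l2)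

lemma opnorm_set_bdd:
  assumes "bop T" shows "bdd_above {hnorm (T x) |x. x \<in> l2 \<and> hnorm x \<le> 1}"
proof -
  obtain D where D: "0 \<le> D" "\<And>x. x \<in> l2 \<Longrightarrow> hnorm (T x) \<le> D * hnorm x"
    using bop_bounded[OF assms(1)] by blast
  have "hnorm (T x) \<le> D" if "x \<in> l2" "hnorm x \<le> 1" for x
    using D(2)[OF that(1)] mult_left_mono[OF that(2) D(1)] by simp
  then show ?thesis by (intro bdd_aboveI[of _ D]) auto
qed

lemma hnorm_zero [simp]: "hnorm (\<lambda>n. 0) = 0"
  by (simp add: hnorm_def)

lemma hnorm_eq_0: "x \<in> l2 \<Longrightarrow> hnorm x = 0 \<Longrightarrow> x = (\<lambda>n. 0)"
  using hnorm_coord_le[of x] by (auto simp: fun_eq_iff)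

lemma opnorm_leI:
  assumes "\<And>x. x \<in> l2 \<Longrightarrow> hnorm x \<le> 1 \<Longrightarrow> hnorm (T x) \<le> C"
  shows "opnorm T \<le> C"
  unfolding opnorm_def
proof (rule cSup_least)
  have "hnorm (T (\<lambda>n. 0)) \<in> {hnorm (T x) |x. x \<in> l2 \<and> hnorm x \<le> 1}"
    by (auto intro!: exI[of _ "\<lambda>n. 0"])
  then show "{hnorm (T x) |x. x \<in> l2 \<and> hnorm x \<le> 1} \<noteq> {}" by blast
qed (use assms in auto)

lemma hnorm_le_opnorm1:
  "bop T \<Longrightarrow> x \<in> l2 \<Longrightarrow> hnorm x \<le> 1 \<Longrightarrow> hnorm (T x) \<le> opnorm T"
  unfolding opnorm_def by (rule cSup_upper[OF _ opnorm_set_bdd]) auto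

lemma hnorm_le_opnorm:
  assumes "bop T" "x \<in> l2" shows "hnorm (T x) \<le> opnorm T * hnorm x"
proof (cases "hnorm x = 0")
  case True
  then show ?thesis using hnorm_eq_0[OF assms(2)] bop_zero[OF assms(1)] by simp
next
  case False
  then have pos: "0 < hnorm x" using hnorm_nonneg[OF assms(2)] by simp
  define c where "c = complex_of_real (1 / hnorm x)"
  have c: "cmod c = 1 / hnorm x" using pos by (simp add: c_def norm_divide)
  have "hnorm (T (vscale c x)) \<le> opnorm T"
    using assms pos by (intro hnorm_le_opnorm1) (auto simp: hnorm_scale c)
  then have "hnorm (T x) / hnorm x \<le> opnorm T"
    using assms c by (simp add: bop_scale hnorm_scale bop_l2)
  then show ?thesis using pos by (simp add: divide_le_eq)
qed

lemma opnorm_nonneg: "bop T \<Longrightarrow> 0 \<le> opnorm T"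
  using hnorm_le_opnorm1[of T "\<lambda>n. 0"] by (simp add: bop_zero)

text \<open>Commutation is an identity between matrix elements, so this weak form of norm
  convergence is enough to pass it to limits.\<close>

lemma opnorm_limit_weak:
  assumes f: "\<And>k. bop (f k)" and T: "bop T" and lim: "(\<lambda>k. opnorm (opminus (f k) T)) \<longlonglongrightarrow> 0"
    and x: "x \<in> l2" and y: "y \<in> l2"
  shows "(\<lambda>k. hinner y (f k x)) \<longlonglongrightarrow> hinner y (T x)"
proof -
  have "(\<lambda>k. hnorm y * (opnorm (opminus (f k) T) * hnorm x)) \<longlonglongrightarrow> hnorm y * (0 * hnorm x)"
    by (intro tendsto_intros lim)
  then have z: "(\<lambda>k. hnorm y * (opnorm (opminus (f k) T) * hnorm x)) \<longlonglongrightarrow> 0" by simp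
  have "cmod (hinner y (f k x) - hinner y (T x)) \<le> hnorm y * (opnorm (opminus (f k) T) * hnorm x)" for k
  proof -
    have "hinner y (f k x) - hinner y (T x) = hinner y (opminus (f k) T x)"
      using f T x y by (simp add: opminus_def hinner_diff_right bop_l2)
    also have "cmod \<dots> \<le> hnorm y * hnorm (opminus (f k) T x)"
      by (rule hinner_Cauchy_Schwarz[OF y bop_l2[OF bop_opminus[OF f T]]])
    also have "\<dots> \<le> hnorm y * (opnorm (opminus (f k) T) * hnorm x)"
      using f T x y by (intro mult_left_mono hnorm_le_opnorm bop_opminus hnorm_nonneg)
    finally show ?thesis .
  qed
  then have "(\<lambda>k. hinner y (f k x) - hinner y (T x)) \<longlonglongrightarrow> 0"
    by (rule null_seq_comparison[OF z])
  then show ?thesis by (simp add: LIM_zero_iff)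
qed

text \<open>Riesz representation: the coefficients of the representing vector are square summable
because testing the functional on their truncations bounds the partial sums.\<close>

definition trunc :: "vec \<Rightarrow> nat \<Rightarrow> vec" where
  "trunc x N = (\<lambda>n. if n < N then x n else 0)"

lemma trunc_l2 [simp]: "trunc x N \<in> l2"
  by (rule l2_finite_support[of "{..<N}"]) (auto simp: trunc_def)

lemma hnorm_trunc: "(hnorm (trunc x N))\<^sup>2 = (\<Sum>n<N. (cmod (x n))\<^sup>2)"
proof -
  have "(\<Sum>n. (cmod (trunc x N n))\<^sup>2) = (\<Sum>n<N. (cmod (trunc x N n))\<^sup>2)"
    by (rule suminf_finite) (auto simp: trunc_def)
  also have "\<dots> = (\<Sum>n<N. (cmod (x n))\<^sup>2)" by (simp add: trunc_def)
  finally show ?thesis unfolding hnorm_def by (simp add: sum_nonneg)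
qed

lemma trunc_tendsto:
  assumes "x \<in> l2" shows "(\<lambda>N. hnorm (\<lambda>n. x n - trunc x N n)) \<longlonglongrightarrow> 0"
proof -
  have eq: "(\<Sum>n. (cmod (x n - trunc x N n))\<^sup>2) = (\<Sum>n. (cmod (x n))\<^sup>2) - (\<Sum>n<N. (cmod (x n))\<^sup>2)" for N
  proof -
    have "(\<Sum>n. (cmod (x n - trunc x N n))\<^sup>2)
        = (\<Sum>n. (cmod (x (n + N) - trunc x N (n + N)))\<^sup>2) + (\<Sum>n<N. (cmod (x n - trunc x N n))\<^sup>2)"
      by (rule suminf_split_initial_segment) (use assms in \<open>auto intro!: l2_summable\<close>)
    also have "\<dots> = (\<Sum>n. (cmod (x (n + N)))\<^sup>2)" by (simp add: trunc_def)
    finally show ?thesis using suminf_minus_initial_segment[OF l2_summable[OF assms], of N] by simp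
  qed
  have "(\<lambda>N. (\<Sum>n. (cmod (x n))\<^sup>2) - (\<Sum>n<N. (cmod (x n))\<^sup>2)) \<longlonglongrightarrow> (\<Sum>n. (cmod (x n))\<^sup>2) - (\<Sum>n. (cmod (x n))\<^sup>2)"
    by (intro tendsto_diff tendsto_const summable_LIMSEQ l2_summable assms)
  then have "(\<lambda>N. sqrt ((\<Sum>n. (cmod (x n))\<^sup>2) - (\<Sum>n<N. (cmod (x n))\<^sup>2))) \<longlonglongrightarrow> sqrt 0"
    by (intro tendsto_real_sqrt) simp
  then show ?thesis by (simp add: hnorm_def eq)
qed

lemma linear_functional_sum:
  assumes add: "\<And>x y. x \<in> l2 \<Longrightarrow> y \<in> l2 \<Longrightarrow> F (vadd x y) = F x + F y"
    and scale: "\<And>x c. x \<in> l2 \<Longrightarrow> F (vscale c x) = c * F x"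
  shows "F (trunc x N) = (\<Sum>n<N. F (unitvec n) * x n)"
proof (induction N)
  case 0
  have "F (\<lambda>n. 0) = 0" using scale[of "\<lambda>n. 0" 0] by simp
  then show ?case by (simp add: trunc_def)
next
  case (Suc N)
  have "trunc x (Suc N) = vadd (trunc x N) (vscale (x N) (unitvec N))"
    by (auto simp: trunc_def unitvec_def fun_eq_iff less_Suc_eq)
  then show ?case using Suc add[OF trunc_l2 l2_scale[OF unitvec_l2]] scale[OF unitvec_l2]
    by (simp add: mult.commute)
qed

lemma Riesz_l2:
  assumes add: "\<And>x y. x \<in> l2 \<Longrightarrow> y \<in> l2 \<Longrightarrow> F (vadd x y) = F x + F y"
    and scale: "\<And>x c. x \<in> l2 \<Longrightarrow> F (vscale c x) = c * F x"
    and bound: "\<And>x. x \<in> l2 \<Longrightarrow> cmod (F x) \<le> C * hnorm x"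
  shows "\<exists>z\<in>l2. \<forall>x\<in>l2. hinner z x = F x"
proof -
  \<comment> \<open>The conjugate compensates for \<open>hinner\<close> being antilinear in its
    first argument.\<close>
  define z where "z n = cnj (F (unitvec n))" for n
  have C: "0 \<le> C"
  proof -
    have "0 \<le> C * hnorm (unitvec 0)"
      using bound[OF unitvec_l2, of 0] norm_ge_zero order_trans by blast
    moreover have "0 < hnorm (unitvec 0)"
      using hnorm_coord_le[OF unitvec_l2, of 0 0] by (simp add: unitvec_def)
    ultimately show ?thesis by (simp add: zero_le_mult_iff)
  qed
  have trunc: "F (trunc x N) = (\<Sum>n<N. F (unitvec n) * x n)" for x N
    by (rule linear_functional_sum) (use add scale in \<open>simp_all\<close>)
  have part: "(\<Sum>n<N. (cmod (z n))\<^sup>2) \<le> C\<^sup>2" for N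
  proof -
    let ?s = "\<Sum>n<N. (cmod (z n))\<^sup>2"
    have "F (trunc z N) = (\<Sum>n<N. complex_of_real ((cmod (z n))\<^sup>2))"
      unfolding trunc
      by (rule sum.cong) (simp_all add: z_def complex_norm_square del: of_real_power)
    then have "F (trunc z N) = complex_of_real ?s" by simp
    then have "?s \<le> C * hnorm (trunc z N)"
      using bound[OF trunc_l2, of z N] by (simp add: sum_nonneg del: of_real_sum)
    moreover have s: "?s = hnorm (trunc z N) * hnorm (trunc z N)"
      using hnorm_trunc[of z N] by (simp add: power2_eq_square)
    ultimately have "hnorm (trunc z N) \<le> C"
      using C hnorm_nonneg[OF trunc_l2, of z N]
      by (metis mult_right_le_imp_le order_le_less)
    then show ?thesis
      unfolding hnorm_trunc[symmetric] by (intro power_mono hnorm_nonneg) auto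
  qed
  have z: "z \<in> l2"
    unfolding l2_def mem_Collect_eq
    by (rule bounded_imp_summable[of _ "C\<^sup>2"]) (use part[of "Suc _"] in \<open>auto simp: lessThan_Suc_atMost\<close>)
  have "hinner z x = F x" if x: "x \<in> l2" for x
  proof -
    have "(\<lambda>N. \<Sum>n<N. cnj (z n) * x n) \<longlonglongrightarrow> hinner z x"
      unfolding hinner_def by (rule summable_LIMSEQ[OF summable_hinner[OF z x]])
    then have 1: "(\<lambda>N. F (trunc x N)) \<longlonglongrightarrow> hinner z x"
      by (simp add: trunc z_def)
    have "cmod (F (trunc x N) - F x) \<le> C * hnorm (\<lambda>n. x n - trunc x N n)" for N
    proof -
      have d: "(\<lambda>n. x n - trunc x N n) \<in> l2" using x by auto
      have "F x = F (vadd (trunc x N) (\<lambda>n. x n - trunc x N n))" by simp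
      also have "\<dots> = F (trunc x N) + F (\<lambda>n. x n - trunc x N n)" by (rule add[OF trunc_l2 d])
      finally have "cmod (F (trunc x N) - F x) = cmod (F (\<lambda>n. x n - trunc x N n))"
        by (simp add: norm_minus_commute)
      then show ?thesis using bound[OF d] by simp
    qed
    moreover have "(\<lambda>N. C * hnorm (\<lambda>n. x n - trunc x N n)) \<longlonglongrightarrow> 0"
      using tendsto_mult_right_zero[OF trunc_tendsto[OF x]] .
    ultimately have "(\<lambda>N. F (trunc x N) - F x) \<longlonglongrightarrow> 0"
      by (intro null_seq_comparison[of "\<lambda>N. C * hnorm (\<lambda>n. x n - trunc x N n)"])
    then have "(\<lambda>N. F (trunc x N)) \<longlonglongrightarrow> F x" by (simp add: LIM_zero_iff)
    then show ?thesis using LIMSEQ_unique[OF 1] by blast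
  qed
  then show ?thesis using z by blast
qed

section \<open>Adjoints\<close>

definition is_adj :: "op \<Rightarrow> op \<Rightarrow> bool" where
  "is_adj T S \<longleftrightarrow> (\<forall>x\<in>l2. \<forall>y\<in>l2. hinner (S y) x = hinner y (T x))"

lemma hinner_left_cancel:
  assumes "a \<in> l2" "b \<in> l2" "\<And>x. x \<in> l2 \<Longrightarrow> hinner a x = hinner b x" shows "a = b"
proof
  fix n
  have "cnj (a n) = cnj (b n)"
    using hinner_cnj[OF unitvec_l2 assms(1), of n] hinner_cnj[OF unitvec_l2 assms(2), of n]
      assms(3)[OF unitvec_l2, of n] by simp
  then show "a n = b n" by simp
qed

lemma adj_eqI:
  assumes "bop T" "bop S" "is_adj T S" shows "adj T = S"
proof
  fix y
  show "adj T y = S y"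
  proof (cases "y \<in> l2")
    case True
    have "(THE z. z \<in> l2 \<and> (\<forall>x\<in>l2. hinner z x = hinner y (T x))) = S y"
    proof (rule the_equality)
      show "S y \<in> l2 \<and> (\<forall>x\<in>l2. hinner (S y) x = hinner y (T x))"
        using assms True bop_l2 by (simp add: is_adj_def)
      fix z assume z: "z \<in> l2 \<and> (\<forall>x\<in>l2. hinner z x = hinner y (T x))"
      show "z = S y"
        by (rule hinner_left_cancel) (use z assms True in \<open>simp_all add: is_adj_def bop_l2\<close>)
    qed
    then show ?thesis using True by (simp add: adj_def)
  qed (use assms(2) bop_outside in \<open>simp add: adj_def\<close>)
qed

text \<open>The definite description in \<open>adj\<close> denotes only once a representing vector
  exists. Riesz supplies one for each y; linearity and boundedness of the resulting map are then
  forced by the defining identity.\<close>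

lemma ex_adj:
  assumes "bop T" shows "\<exists>S. bop S \<and> is_adj T S"
proof -
  obtain C where C: "0 \<le> C" "\<And>x. x \<in> l2 \<Longrightarrow> hnorm (T x) \<le> C * hnorm x"
    using bop_bounded[OF assms] by blast
  have "\<exists>z\<in>l2. \<forall>x\<in>l2. hinner z x = hinner y (T x)" if y: "y \<in> l2" for y
  proof (rule Riesz_l2)
    fix x assume x: "x \<in> l2"
    have "cmod (hinner y (T x)) \<le> hnorm y * hnorm (T x)"
      by (rule hinner_Cauchy_Schwarz[OF y bop_l2[OF assms]])
    also have "\<dots> \<le> hnorm y * (C * hnorm x)"
      by (rule mult_left_mono[OF C(2)[OF x] hnorm_nonneg[OF y]])
    finally show "cmod (hinner y (T x)) \<le> hnorm y * C * hnorm x" by (simp add: mult.assoc)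
  qed (simp_all add: bop_add[OF assms] bop_scale[OF assms] bop_l2[OF assms] y
        hinner_add_right hinner_scale_right)
  then obtain S0 where S0: "\<And>y. y \<in> l2 \<Longrightarrow> S0 y \<in> l2"
      "\<And>y x. y \<in> l2 \<Longrightarrow> x \<in> l2 \<Longrightarrow> hinner (S0 y) x = hinner y (T x)"
    by metis
  define S where "S y = (if y \<in> l2 then S0 y else (\<lambda>n. 0))" for y
  have Sl2: "S y \<in> l2" for y using S0 by (simp add: S_def)
  have S: "hinner x (S y) = hinner (T x) y" if "x \<in> l2" "y \<in> l2" for x y
  proof -
    have "hinner x (S y) = cnj (hinner (S y) x)" using that Sl2 by (simp add: hinner_cnj)
    also have "\<dots> = cnj (hinner y (T x))" using that S0 by (simp add: S_def)
    finally show ?thesis using that bop_l2[OF assms] by (simp add: hinner_cnj)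
  qed
  have "bop S"
  proof (rule bopI[where C = C])
    fix x y assume xy: "x \<in> l2" "y \<in> l2"
    have "hinner (unitvec n) (S (vadd x y)) = hinner (unitvec n) (vadd (S x) (S y))" for n
      unfolding hinner_add_right[OF unitvec_l2 Sl2 Sl2]
      using xy bop_l2[OF assms] by (simp only: S unitvec_l2 l2_add hinner_add_right)
    then show "S (vadd x y) = vadd (S x) (S y)" by (simp add: fun_eq_iff)
  next
    fix x c assume x: "x \<in> l2"
    have "hinner (unitvec n) (S (vscale c x)) = hinner (unitvec n) (vscale c (S x))" for n
      unfolding hinner_scale_right[OF unitvec_l2 Sl2]
      using x bop_l2[OF assms] by (simp only: S unitvec_l2 l2_scale hinner_scale_right)
    then show "S (vscale c x) = vscale c (S x)" by (simp add: fun_eq_iff)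
  next
    fix x assume x: "x \<in> l2"
    \<comment> \<open>||S x||^2 = <T (S x), x> <= C ||S x|| ||x||, and one factor ||S x|| cancels
      unless it is 0.\<close>
    have "hinner (S x) (S x) = hinner (T (S x)) x" by (rule S[OF Sl2 x])
    then have "(hnorm (S x))\<^sup>2 = cmod (hinner (T (S x)) x)"
      using hinner_self[OF Sl2, of x] by (metis norm_of_real abs_power2)
    also have "\<dots> \<le> hnorm (T (S x)) * hnorm x"
      by (rule hinner_Cauchy_Schwarz[OF bop_l2[OF assms] x])
    also have "\<dots> \<le> (C * hnorm (S x)) * hnorm x"
      by (rule mult_right_mono[OF C(2)[OF Sl2] hnorm_nonneg[OF x]])
    finally have "hnorm (S x) * hnorm (S x) \<le> hnorm (S x) * (C * hnorm x)"
      by (simp add: power2_eq_square mult_ac)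
    then have "hnorm (S x) \<le> 0 \<or> hnorm (S x) \<le> C * hnorm x"
      by (metis linorder_not_le mult_le_cancel_left_pos)
    moreover have "0 \<le> C * hnorm x" using C(1) hnorm_nonneg[OF x] by (rule mult_nonneg_nonneg)
    ultimately show "hnorm (S x) \<le> C * hnorm x" by linarith
  qed (use S0(1) in \<open>simp_all add: S_def\<close>)
  moreover have "is_adj T S" using S0 by (simp add: is_adj_def S_def)
  ultimately show ?thesis by blast
qed

lemma bop_adj: "bop T \<Longrightarrow> bop (adj T)"
  and is_adj_adj: "bop T \<Longrightarrow> is_adj T (adj T)"
  using ex_adj adj_eqI by metis+

lemma hinner_adj_left: "bop T \<Longrightarrow> x \<in> l2 \<Longrightarrow> y \<in> l2 \<Longrightarrow> hinner (adj T y) x = hinner y (T x)"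
  using is_adj_adj by (simp add: is_adj_def)

lemma hinner_adj_right:
  assumes "bop T" "x \<in> l2" "y \<in> l2" shows "hinner y (adj T x) = hinner (T y) x"
proof -
  have "hinner y (adj T x) = cnj (hinner (adj T x) y)"
    using assms by (simp add: hinner_cnj bop_l2[OF bop_adj])
  also have "\<dots> = cnj (hinner x (T y))"
    using assms by (simp add: hinner_adj_left)
  finally show ?thesis using assms by (simp add: hinner_cnj bop_l2)
qed

lemma adj_adj: assumes "bop T" shows "adj (adj T) = T"
  by (rule adj_eqI) (use assms in \<open>simp_all add: bop_adj is_adj_def hinner_adj_right\<close>)

lemma adj_comp: assumes "bop S" "bop T" shows "adj (S \<circ> T) = adj T \<circ> adj S"
  by (rule adj_eqI)
     (use assms in \<open>simp_all add: bop_adj bop_comp is_adj_def hinner_adj_left bop_l2\<close>)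

lemma hinner_add_left:
  assumes "x \<in> l2" "y \<in> l2" "z \<in> l2"
  shows "hinner (vadd y z) x = hinner y x + hinner z x"
proof -
  have "hinner (vadd y z) x = cnj (hinner x (vadd y z))"
    using assms by (simp add: hinner_cnj l2_add)
  also have "\<dots> = cnj (hinner x y) + cnj (hinner x z)"
    using assms by (simp add: hinner_add_right)
  finally show ?thesis using assms by (simp add: hinner_cnj)
qed

lemma hinner_scale_left:
  assumes "x \<in> l2" "y \<in> l2" shows "hinner (vscale c y) x = cnj c * hinner y x"
proof -
  have "hinner (vscale c y) x = cnj (hinner x (vscale c y))"
    using assms by (simp add: hinner_cnj l2_scale)
  also have "\<dots> = cnj c * cnj (hinner x y)"
    using assms by (simp add: hinner_scale_right)
  finally show ?thesis using assms by (simp add: hinner_cnj)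
qed

lemma adj_opadd: assumes "bop S" "bop T" shows "adj (opadd S T) = opadd (adj S) (adj T)"
proof (rule adj_eqI)
  show "is_adj (opadd S T) (opadd (adj S) (adj T))"
    unfolding is_adj_def opadd_def
    using assms by (simp add: hinner_add_left hinner_add_right hinner_adj_left bop_l2 bop_adj)
qed (use assms in \<open>simp_all add: bop_opadd bop_adj\<close>)

lemma adj_opscale: assumes "bop T" shows "adj (opscale c T) = opscale (cnj c) (adj T)"
proof (rule adj_eqI)
  show "is_adj (opscale c T) (opscale (cnj c) (adj T))"
    unfolding is_adj_def opscale_def
    using assms by (simp add: hinner_scale_left hinner_scale_right hinner_adj_left bop_l2 bop_adj)
qed (use assms in \<open>simp_all add: bop_opscale bop_adj\<close>)

section \<open>C*-algebras of operators\<close>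

lemma unital_cstar_subalgI:
  assumes "\<And>T. T \<in> A \<Longrightarrow> bop T" "idop \<in> A"
    and "\<And>S T. S \<in> A \<Longrightarrow> T \<in> A \<Longrightarrow> opadd S T \<in> A"
    and "\<And>c T. T \<in> A \<Longrightarrow> opscale c T \<in> A"
    and "\<And>S T. S \<in> A \<Longrightarrow> T \<in> A \<Longrightarrow> S \<circ> T \<in> A"
    and "\<And>T. T \<in> A \<Longrightarrow> adj T \<in> A"
    and "\<And>f T. (\<And>k. f k \<in> A) \<Longrightarrow> bop T \<Longrightarrow> (\<lambda>k. opnorm (opminus (f k) T)) \<longlonglongrightarrow> 0 \<Longrightarrow> T \<in> A"
  shows "unital_cstar_subalg A"
  unfolding unital_cstar_subalg_def
proof (intro conjI ballI allI impI)
  fix f T assume "(\<forall>k. f k \<in> A) \<and> bop T \<and> (\<lambda>k. opnorm (opminus (f k) T)) \<longlonglongrightarrow> 0"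
  then show "T \<in> A" using assms(7)[of f T] by simp
qed (rule assms; assumption)+

lemma
  assumes "unital_cstar_subalg A"
  shows cstar_bop: "T \<in> A \<Longrightarrow> bop T"
    and cstar_idop: "idop \<in> A"
    and cstar_opadd: "S \<in> A \<Longrightarrow> T \<in> A \<Longrightarrow> opadd S T \<in> A"
    and cstar_opscale: "T \<in> A \<Longrightarrow> opscale c T \<in> A"
    and cstar_comp: "S \<in> A \<Longrightarrow> T \<in> A \<Longrightarrow> S \<circ> T \<in> A"
    and cstar_adj: "T \<in> A \<Longrightarrow> adj T \<in> A"
    and cstar_limit: "(\<And>k. f k \<in> A) \<Longrightarrow> bop T \<Longrightarrow> (\<lambda>k. opnorm (opminus (f k) T)) \<longlonglongrightarrow> 0 \<Longrightarrow> T \<in> A"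
proof -
  have 1: "\<forall>T\<in>A. bop T" and 2: "idop \<in> A"
    and 3: "\<forall>S\<in>A. \<forall>T\<in>A. opadd S T \<in> A" and 4: "\<forall>c. \<forall>T\<in>A. opscale c T \<in> A"
    and 5: "\<forall>S\<in>A. \<forall>T\<in>A. S \<circ> T \<in> A" and 6: "\<forall>T\<in>A. adj T \<in> A"
    and 7: "\<forall>f T. (\<forall>k. f k \<in> A) \<and> bop T \<and> (\<lambda>k. opnorm (opminus (f k) T)) \<longlonglongrightarrow> 0 \<longrightarrow> T \<in> A"
    using assms unfolding unital_cstar_subalg_def by - (elim conjE, assumption)+
  show "T \<in> A \<Longrightarrow> bop T" by (rule bspec[OF 1])
  show "idop \<in> A" by (rule 2)
  show "S \<in> A \<Longrightarrow> T \<in> A \<Longrightarrow> opadd S T \<in> A" by (rule bspec[OF bspec[OF 3]])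
  show "T \<in> A \<Longrightarrow> opscale c T \<in> A" by (rule bspec[OF spec[OF 4]])
  show "S \<in> A \<Longrightarrow> T \<in> A \<Longrightarrow> S \<circ> T \<in> A" by (rule bspec[OF bspec[OF 5]])
  show "T \<in> A \<Longrightarrow> adj T \<in> A" by (rule bspec[OF 6])
  show "T \<in> A" if "\<And>k. f k \<in> A" "bop T" "(\<lambda>k. opnorm (opminus (f k) T)) \<longlonglongrightarrow> 0"
    by (rule 7[THEN spec, of f, THEN spec, of T, THEN mp]) (intro conjI allI that)
qed

lemma cstar_all_bops: "unital_cstar_subalg {T. bop T}"
  by (rule unital_cstar_subalgI)
     (simp_all add: bop_opadd bop_opscale bop_comp bop_adj)

section \<open>Generated C*-algebras and commutants\<close>

lemma cstar_gen_superset: "S \<subseteq> cstar_gen S"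
  by (auto simp: cstar_gen_def)

lemma cstar_gen_least: "unital_cstar_subalg B \<Longrightarrow> S \<subseteq> B \<Longrightarrow> cstar_gen S \<subseteq> B"
  by (auto simp: cstar_gen_def)

lemma cstar_gen_mono: "S \<subseteq> S' \<Longrightarrow> cstar_gen S \<subseteq> cstar_gen S'"
  by (auto simp: cstar_gen_def)

lemma cstar_genI: "(\<And>B. unital_cstar_subalg B \<Longrightarrow> S \<subseteq> B \<Longrightarrow> T \<in> B) \<Longrightarrow> T \<in> cstar_gen S"
  by (simp add: cstar_gen_def)

lemma cstar_gen_cstar:
  assumes "\<And>T. T \<in> S \<Longrightarrow> bop T" shows "unital_cstar_subalg (cstar_gen S)"
proof (rule unital_cstar_subalgI)
  show "bop T" if "T \<in> cstar_gen S" for T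
    using that cstar_gen_least[OF cstar_all_bops, of S] assms by auto
  show "T \<in> cstar_gen S"
    if "\<And>k. f k \<in> cstar_gen S" "bop T" "(\<lambda>k. opnorm (opminus (f k) T)) \<longlonglongrightarrow> 0" for f T
  proof (rule cstar_genI)
    fix B assume B: "unital_cstar_subalg B" "S \<subseteq> B"
    have "f k \<in> B" for k using that(1)[of k] cstar_gen_least[OF B] by auto
    then show "T \<in> B" using cstar_limit[OF B(1), of f T] that(2,3) by simp
  qed
qed (auto simp: cstar_gen_def cstar_idop cstar_opadd cstar_opscale cstar_comp cstar_adj)

lemma cstar_gen_Un_gen:
  "cstar_gen (cstar_gen S \<union> cstar_gen S') = cstar_gen (S \<union> S')"
proof
  show "cstar_gen (S \<union> S') \<subseteq> cstar_gen (cstar_gen S \<union> cstar_gen S')"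
    using cstar_gen_superset by (intro cstar_gen_mono) auto
  show "cstar_gen (cstar_gen S \<union> cstar_gen S') \<subseteq> cstar_gen (S \<union> S')"
  proof
    fix T assume T: "T \<in> cstar_gen (cstar_gen S \<union> cstar_gen S')"
    show "T \<in> cstar_gen (S \<union> S')"
    proof (rule cstar_genI)
      fix B assume B: "unital_cstar_subalg B" "S \<union> S' \<subseteq> B"
      then have "cstar_gen S \<union> cstar_gen S' \<subseteq> B"
        using cstar_gen_least[of B] by simp
      then show "T \<in> B" using T by (rule subsetD[OF cstar_gen_least[OF B(1)]])
    qed
  qed
qed

text \<open>Moving R to the other side turns both orders of the product into matrix elements of
  \<open>f k\<close> itself between fixed vectors, where the limit is available.\<close>

lemma commute_limit:
  assumes f: "\<And>k. bop (f k)" "\<And>k. f k \<circ> R = R \<circ> f k" and R: "bop R" and T: "bop T"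
    and lim: "(\<lambda>k. opnorm (opminus (f k) T)) \<longlonglongrightarrow> 0"
  shows "T \<circ> R = R \<circ> T"
proof (rule bop_eqI_hinner)
  fix x y assume x: "x \<in> l2" and y: "y \<in> l2"
  have "(\<lambda>k. hinner y (f k (R x))) \<longlonglongrightarrow> hinner y (T (R x))"
    by (rule opnorm_limit_weak) (use f R T lim x y bop_l2 in simp_all)
  moreover have "(\<lambda>k. hinner (adj R y) (f k x)) \<longlonglongrightarrow> hinner (adj R y) (T x)"
    by (rule opnorm_limit_weak) (use f R T lim x y bop_l2 bop_adj in simp_all)
  moreover have "hinner y (f k (R x)) = hinner (adj R y) (f k x)" for k
  proof -
    have "f k (R x) = R (f k x)" using fun_cong[OF f(2)[of k], of x] by simp
    then show ?thesis using f R x y by (simp add: hinner_adj_left bop_l2)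
  qed
  ultimately have "hinner y (T (R x)) = hinner (adj R y) (T x)"
    using LIMSEQ_unique by simp
  then show "hinner y ((T \<circ> R) x) = hinner y ((R \<circ> T) x)"
    using R T x y by (simp add: hinner_adj_left bop_l2)
qed (use R T bop_comp in simp_all)

text \<open>Requiring commutation with \<open>adj R\<close> too is what closes the set under
  adjoints: the adjoint of R* T = T R* reads T* R = R T*. The lemma acts as an induction principle:
  since \<open>cstar_gen\<close> is an intersection, a property of the generators reaches every
  element as soon as it is membership in some C*-algebra.\<close>

lemma commutant_cstar:
  assumes R: "bop R"
  shows "unital_cstar_subalg {T. bop T \<and> T \<circ> R = R \<circ> T \<and> T \<circ> adj R = adj R \<circ> T}"
proof -
  note R' = bop_adj[OF R]
  show ?thesis
  proof (rule unital_cstar_subalgI, unfold mem_Collect_eq)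
    fix T assume T: "bop T \<and> T \<circ> R = R \<circ> T \<and> T \<circ> adj R = adj R \<circ> T"
    then have T': "bop T" "adj R \<circ> T = T \<circ> adj R" "R \<circ> T = T \<circ> R" by simp_all
    have "adj T \<circ> R = adj (adj R \<circ> T)"
      using T'(1) R R' by (simp add: adj_comp adj_adj)
    also have "\<dots> = R \<circ> adj T"
      unfolding T'(2) using T'(1) R R' by (simp add: adj_comp adj_adj)
    finally have 1: "adj T \<circ> R = R \<circ> adj T" .
    have "adj T \<circ> adj R = adj (R \<circ> T)"
      using T'(1) R by (simp add: adj_comp)
    also have "\<dots> = adj R \<circ> adj T"
      unfolding T'(3) using T'(1) R by (simp add: adj_comp)
    finally show "bop (adj T) \<and> adj T \<circ> R = R \<circ> adj T \<and> adj T \<circ> adj R = adj R \<circ> adj T"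
      using 1 bop_adj[OF T'(1)] by simp
  next
    fix f :: "nat \<Rightarrow> op" and T
    assume f: "\<And>k. bop (f k) \<and> f k \<circ> R = R \<circ> f k \<and> f k \<circ> adj R = adj R \<circ> f k"
      and "bop T" "(\<lambda>k. opnorm (opminus (f k) T)) \<longlonglongrightarrow> 0"
    then show "bop T \<and> T \<circ> R = R \<circ> T \<and> T \<circ> adj R = adj R \<circ> T"
      using commute_limit[of f R T] commute_limit[of f "adj R" T] R R' by simp
  next
    fix S T assume ST: "bop S \<and> S \<circ> R = R \<circ> S \<and> S \<circ> adj R = adj R \<circ> S"
       "bop T \<and> T \<circ> R = R \<circ> T \<and> T \<circ> adj R = adj R \<circ> T"
    have "S \<circ> T \<circ> Q = Q \<circ> (S \<circ> T)" if "S \<circ> Q = Q \<circ> S" "T \<circ> Q = Q \<circ> T" for Q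
      using that by (metis comp_assoc)
    then show "bop (S \<circ> T) \<and> S \<circ> T \<circ> R = R \<circ> (S \<circ> T) \<and> S \<circ> T \<circ> adj R = adj R \<circ> (S \<circ> T)"
      using ST bop_comp by simp
  qed (use R R' in \<open>auto simp: bop_opadd bop_opscale opadd_comp comp_opadd opscale_comp comp_opscale\<close>)
qed

lemma cstar_gen_commute:
  assumes "\<And>s. s \<in> S \<Longrightarrow> bop s" "bop R"
    and "\<And>s. s \<in> S \<Longrightarrow> s \<circ> R = R \<circ> s" "\<And>s. s \<in> S \<Longrightarrow> s \<circ> adj R = adj R \<circ> s"
    and "T \<in> cstar_gen S"
  shows "T \<circ> R = R \<circ> T"
  using cstar_gen_least[OF commutant_cstar[OF assms(2)], of S] assms by auto

text \<open>The commutant argument is run twice: first on the left algebra against a single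
  generator of the right one, then on the right algebra against a fixed element a of the left one.
  The second run also involves \<open>adj a\<close>, which lies in the left algebra again; for the
  first, self-adjoint generators make the condition on adjoints automatic.\<close>

lemma commute_algs_cstar_gen:
  assumes S: "\<And>s. s \<in> S \<Longrightarrow> bop s \<and> adj s = s" and S': "\<And>s. s \<in> S' \<Longrightarrow> bop s \<and> adj s = s"
    and comm: "\<And>s s'. s \<in> S \<Longrightarrow> s' \<in> S' \<Longrightarrow> s \<circ> s' = s' \<circ> s"
  shows "commute_algs (cstar_gen S) (cstar_gen S')"
  unfolding commute_algs_def
proof (intro ballI)
  fix a b assume a: "a \<in> cstar_gen S" and b: "b \<in> cstar_gen S'"
  have 1: "t \<circ> s' = s' \<circ> t" if "s' \<in> S'" "t \<in> cstar_gen S" for s' t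
    by (rule cstar_gen_commute[where S = S]) (use that S S' comm in auto)
  have A: "unital_cstar_subalg (cstar_gen S)" by (rule cstar_gen_cstar) (use S in auto)
  have "b \<circ> a = a \<circ> b"
    by (rule cstar_gen_commute[where S = S'])
      (use a b S' 1 cstar_bop[OF A] cstar_adj[OF A] in \<open>auto simp: 1[symmetric]\<close>)
  then show "a \<circ> b = b \<circ> a" by simp
qed

section \<open>Unitaries and conjugation by them\<close>

lemma
  assumes "unitary U"
  shows unitary_bop: "bop U" and unitary_adj_comp: "adj U \<circ> U = idop"
    and unitary_comp_adj: "U \<circ> adj U = idop"
  using assms by (simp_all add: unitary_def)

lemma unitary_adj: "unitary U \<Longrightarrow> unitary (adj U)"
  by (simp add: unitary_def bop_adj adj_adj)

lemma unitary_hinner: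
  assumes "unitary U" "x \<in> l2" "y \<in> l2" shows "hinner (U x) (U y) = hinner x y"
proof -
  have "hinner (U x) (U y) = hinner x (adj U (U y))"
    using assms by (simp add: hinner_adj_right unitary_bop bop_l2)
  moreover have "adj U (U y) = y"
    using fun_cong[OF unitary_adj_comp[OF assms(1)], of y] assms by (simp add: idop_def)
  ultimately show ?thesis by simp
qed

lemma unitary_hnorm:
  assumes "unitary U" "x \<in> l2" shows "hnorm (U x) = hnorm x"
proof -
  have "complex_of_real ((hnorm (U x))\<^sup>2) = complex_of_real ((hnorm x)\<^sup>2)"
    using hinner_self[OF assms(2)] hinner_self[OF bop_l2[OF unitary_bop[OF assms(1)], of x]]
      unitary_hinner[OF assms(1,2,2)] by simp
  then have "(hnorm (U x))\<^sup>2 = (hnorm x)\<^sup>2" by (simp only: of_real_eq_iff)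
  then show ?thesis
    using assms by (simp add: power2_eq_iff_nonneg bop_l2 unitary_bop)
qed

lemma opnorm_unitary_le: "unitary U \<Longrightarrow> opnorm U \<le> 1"
  by (rule opnorm_leI) (simp add: unitary_hnorm)

lemma bop_conjop: "bop U \<Longrightarrow> bop T \<Longrightarrow> bop (conjop U T)"
  by (simp add: conjop_def bop_comp bop_adj)

lemma conjop_id:
  assumes "unitary U" "bop T" "T \<circ> U = U \<circ> T" shows "conjop U T = T"
proof -
  have "conjop U T = (adj U \<circ> U) \<circ> T" unfolding conjop_def comp_assoc using assms(3) by simp
  then show ?thesis using assms by (simp only: unitary_adj_comp idop_comp)
qed

lemma conjop_adj_conjop:
  assumes "unitary U" "bop T" shows "conjop U (conjop (adj U) T) = T"
proof -
  have "conjop U (conjop (adj U) T) = (adj U \<circ> U) \<circ> T \<circ> (adj U \<circ> U)"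
    using assms by (simp add: conjop_def adj_adj unitary_bop comp_assoc)
  then show ?thesis using assms by (simp only: unitary_adj_comp idop_comp)
qed

lemma conjop_comp:
  assumes "unitary U" "bop S" "bop T"
  shows "conjop U (S \<circ> T) = conjop U S \<circ> conjop U T"
proof -
  have "conjop U S \<circ> conjop U T = adj U \<circ> (S \<circ> (U \<circ> adj U)) \<circ> T \<circ> U"
    by (simp add: conjop_def comp_assoc)
  then show ?thesis using assms
    by (simp only: unitary_comp_adj idop_comp conjop_def comp_assoc)
qed

lemma conjop_opadd:
  "bop U \<Longrightarrow> bop S \<Longrightarrow> bop T \<Longrightarrow> conjop U (opadd S T) = opadd (conjop U S) (conjop U T)"
  by (simp add: conjop_def comp_opadd opadd_comp bop_adj)

lemma conjop_opscale:
  "bop U \<Longrightarrow> bop T \<Longrightarrow> conjop U (opscale c T) = opscale c (conjop U T)"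
  by (simp add: conjop_def comp_opscale opscale_comp bop_adj)

lemma conjop_opminus:
  "bop U \<Longrightarrow> bop S \<Longrightarrow> bop T \<Longrightarrow> conjop U (opminus S T) = opminus (conjop U S) (conjop U T)"
  by (simp add: opminus_eq conjop_opadd conjop_opscale bop_opscale)

lemma adj_conjop:
  "bop U \<Longrightarrow> bop T \<Longrightarrow> adj (conjop U T) = conjop U (adj T)"
  by (simp add: conjop_def adj_comp adj_adj bop_adj bop_comp comp_assoc)

lemma conjop_idop: "unitary U \<Longrightarrow> conjop U idop = idop"
  by (simp add: conjop_id unitary_bop)

lemma opnorm_conjop_le:
  assumes "unitary U" "bop T" shows "opnorm (conjop U T) \<le> opnorm T"
proof (rule opnorm_leI)
  fix x assume x: "x \<in> l2" "hnorm x \<le> 1"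
  have "hnorm (conjop U T x) = hnorm (T (U x))"
    using assms by (simp add: conjop_def unitary_hnorm unitary_adj bop_l2)
  also have "\<dots> \<le> opnorm T"
    using assms x by (intro hnorm_le_opnorm1) (simp_all add: bop_l2 unitary_bop unitary_hnorm)
  finally show "hnorm (conjop U T x) \<le> opnorm T" .
qed

text \<open>The counterpart of the commutant lemma for conjugation: to locate the image of a
  generated algebra, it suffices to look at the generators. Norm limits survive because conjugation
  by a unitary does not increase the operator norm.\<close>

lemma conjop_preimage_cstar:
  assumes B: "unital_cstar_subalg B" and U: "unitary U"
  shows "unital_cstar_subalg {T. bop T \<and> conjop U T \<in> B}"
proof (rule unital_cstar_subalgI, unfold mem_Collect_eq)
  fix f :: "nat \<Rightarrow> op" and T
  assume f: "\<And>k. bop (f k) \<and> conjop U (f k) \<in> B" and T: "bop T"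
    and lim: "(\<lambda>k. opnorm (opminus (f k) T)) \<longlonglongrightarrow> 0"
  have "opnorm (opminus (conjop U (f k)) (conjop U T)) \<le> opnorm (opminus (f k) T)" for k
    using opnorm_conjop_le[OF U bop_opminus[of "f k" T]] f[of k] T U
    by (simp add: conjop_opminus unitary_bop)
  moreover have "0 \<le> opnorm (opminus (conjop U (f k)) (conjop U T))" for k
    using f[of k] T U by (simp add: opnorm_nonneg bop_opminus bop_conjop unitary_bop)
  ultimately have "(\<lambda>k. opnorm (opminus (conjop U (f k)) (conjop U T))) \<longlonglongrightarrow> 0"
    by (intro tendsto_sandwich[OF _ _ tendsto_const lim]) simp_all
  then have "conjop U T \<in> B"
    using cstar_limit[OF B, of "\<lambda>k. conjop U (f k)" "conjop U T"] f T U
    by (simp add: bop_conjop unitary_bop)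
  then show "bop T \<and> conjop U T \<in> B" using T by simp
next
  fix T assume "bop T \<and> conjop U T \<in> B"
  then show "bop (adj T) \<and> conjop U (adj T) \<in> B"
    using cstar_adj[OF B, of "conjop U T"] U by (simp add: adj_conjop bop_adj unitary_bop)
qed (use U in \<open>simp_all add: conjop_idop cstar_idop[OF B] conjop_opadd conjop_opscale conjop_comp
      bop_opadd bop_opscale bop_comp unitary_bop cstar_opadd[OF B] cstar_opscale[OF B] cstar_comp[OF B]\<close>)

lemma conjop_cstar_gen_subset:
  assumes "unitary U" "\<And>s. s \<in> S \<Longrightarrow> bop s"
  shows "conjop U ` cstar_gen S \<subseteq> cstar_gen (conjop U ` S)"
proof -
  have B: "unital_cstar_subalg (cstar_gen (conjop U ` S))"
    by (rule cstar_gen_cstar) (use assms in \<open>auto intro: bop_conjop unitary_bop\<close>)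
  show ?thesis
    using cstar_gen_least[OF conjop_preimage_cstar[OF B assms(1)], of S] assms(2)
      cstar_gen_superset[of "conjop U ` S"] by auto
qed

text \<open>The reverse inclusion is the forward one for \<open>adj U\<close> and the conjugated
  generators.\<close>

lemma conjop_cstar_gen:
  assumes U: "unitary U" and S: "\<And>s. s \<in> S \<Longrightarrow> bop s"
  shows "conjop U ` cstar_gen S = cstar_gen (conjop U ` S)"
proof
  show "conjop U ` cstar_gen S \<subseteq> cstar_gen (conjop U ` S)"
    by (rule conjop_cstar_gen_subset[OF assms])
  have S': "bop s" if "s \<in> conjop U ` S" for s
    using that U S by (auto intro: bop_conjop unitary_bop)
  have "conjop (adj U) (conjop U s) = s" if "bop s" for s
    using conjop_adj_conjop[OF unitary_adj[OF U] that] U by (simp add: adj_adj unitary_bop)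
  then have im: "conjop (adj U) ` conjop U ` S = S"
    using S by (force simp: image_image)
  show "cstar_gen (conjop U ` S) \<subseteq> conjop U ` cstar_gen S"
  proof
    fix T assume T: "T \<in> cstar_gen (conjop U ` S)"
    then have "conjop (adj U) T \<in> cstar_gen S"
      using conjop_cstar_gen_subset[OF unitary_adj[OF U], of "conjop U ` S"] S' im by auto
    moreover have "bop T" using cstar_bop[OF cstar_gen_cstar T] S' by simp
    ultimately show "T \<in> conjop U ` cstar_gen S"
      using conjop_adj_conjop[OF U, of T] by (metis imageI)
  qed
qed

section \<open>Signed permutation operators\<close>

text \<open>Coordinates are pulled back along p, so the unit vector at p n is sent to c n times the
  unit vector at n. This is why products below compose the permutations in reverse order.\<close>

definition mono_op :: "(nat \<Rightarrow> complex) \<Rightarrow> (nat \<Rightarrow> nat) \<Rightarrow> op" where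
  "mono_op c p x = (if x \<in> l2 then (\<lambda>n. c n * x (p n)) else (\<lambda>n. 0))"

lemma mono_op_isometric:
  assumes c: "\<And>n. cmod (c n) = 1" and p: "bij p" and x: "x \<in> l2"
  shows "mono_op c p x \<in> l2" "hnorm (mono_op c p x) = hnorm x"
proof -
  have eq: "(\<lambda>n. (cmod (mono_op c p x n))\<^sup>2) = (\<lambda>n. (cmod (x n))\<^sup>2) \<circ> p"
    using c x by (auto simp: mono_op_def norm_mult)
  show "mono_op c p x \<in> l2"
    unfolding l2_def mem_Collect_eq eq
    by (rule summable_reindex) (use x p bij_is_inj in \<open>auto simp: l2_summable\<close>)
  have "suminf ((\<lambda>n. (cmod (x n))\<^sup>2) \<circ> p) = (\<Sum>n. (cmod (x n))\<^sup>2)"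
    by (rule suminf_reindex)
      (use x bij_is_inj[OF p] bij_is_surj[OF p] in \<open>auto simp: l2_summable\<close>)
  then show "hnorm (mono_op c p x) = hnorm x" unfolding hnorm_def eq by simp
qed

lemma bop_mono_op:
  assumes "\<And>n. cmod (c n) = 1" "bij p" shows "bop (mono_op c p)"
proof (rule bopI[where C = 1])
  fix x y assume "x \<in> l2" "y \<in> l2"
  then show "mono_op c p (vadd x y) = vadd (mono_op c p x) (mono_op c p y)"
    by (simp add: mono_op_def l2_add distrib_left)
next
  fix x a assume "x \<in> l2"
  then show "mono_op c p (vscale a x) = vscale a (mono_op c p x)"
    by (simp add: mono_op_def l2_scale mult.left_commute)
qed (use mono_op_isometric[of c p, OF assms] in \<open>simp_all add: mono_op_def\<close>)

lemma mono_op_comp: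
  assumes "\<And>n. cmod (d n) = 1" "bij q"
  shows "mono_op c p \<circ> mono_op d q = mono_op (\<lambda>n. c n * d (p n)) (q \<circ> p)"
proof
  fix x show "(mono_op c p \<circ> mono_op d q) x = mono_op (\<lambda>n. c n * d (p n)) (q \<circ> p) x"
    using mono_op_isometric(1)[of d q, OF assms, of x]
    by (cases "x \<in> l2") (simp_all add: mono_op_def mult.assoc)
qed

lemma mono_op_id: "mono_op (\<lambda>n. 1) id = idop"
  by (auto simp: mono_op_def idop_def)

lemma mono_op_unitvec:
  assumes "bij p"
  shows "mono_op c p (unitvec (p n)) = vscale (c n) (unitvec n)"
  using bij_is_inj[OF assms] unitvec_l2[of "p n"] unfolding mono_op_def
  by (simp add: unitvec_def fun_eq_iff inj_eq)

lemma unitary_mono_op: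
  assumes c: "\<And>n. cmod (c n) = 1" and p: "bij p"
  shows "unitary (mono_op c p)"
proof -
  let ?T = "mono_op c p" and ?S = "mono_op (\<lambda>n. cnj (c (inv p n))) (inv p)"
  have T: "bop ?T" by (rule bop_mono_op[OF assms])
  have S: "bop ?S" by (rule bop_mono_op) (use c bij_imp_bij_inv[OF p] in simp_all)
  have pp: "p (inv p n) = n" "inv p (p n) = n" for n
    using p by (simp_all add: surj_f_inv_f bij_is_surj bij_is_inj)
  have pi: "p \<circ> inv p = id" "inv p \<circ> p = id" by (simp_all add: fun_eq_iff pp)
  have cc: "cnj (c n) * c n = 1" "c n * cnj (c n) = 1" for n
    using complex_norm_square[of "c n"] c[of n] by (simp_all add: mult.commute)
  have "adj ?T = ?S"
  proof (rule bop_eqI[OF bop_adj[OF T] S], rule ext)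
    fix y n assume y: "y \<in> l2"
    \<comment> \<open>Coordinate n of the adjoint is found by letting the operator act on unit
      vector n, written as p (inv p n) so that \<open>mono_op_unitvec\<close> applies.\<close>
    have "adj ?T y n = hinner (unitvec n) (adj ?T y)" by simp
    also have "\<dots> = hinner (?T (unitvec (p (inv p n)))) y"
      unfolding pp by (rule hinner_adj_right[OF T y unitvec_l2])
    also have "\<dots> = cnj (c (inv p n)) * y (inv p n)"
      unfolding mono_op_unitvec[OF p] using y by (simp add: hinner_scale_left)
    finally show "adj ?T y n = ?S y n" using y by (simp add: mono_op_def)
  qed
  moreover have "?T \<circ> ?S = idop"
    using c bij_imp_bij_inv[OF p] p
    by (simp add: mono_op_comp pp cc mono_op_id[symmetric] pi)
  moreover have "?S \<circ> ?T = idop"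
    using c p
    by (simp add: mono_op_comp[of c p, OF c p] pp cc mono_op_id[symmetric] pi)
  ultimately show ?thesis using T by (simp add: unitary_def)
qed

lemma adj_eq_inverse:
  assumes "unitary U" "bop V" "U \<circ> V = idop" shows "adj U = V"
proof -
  have "adj U = adj U \<circ> (U \<circ> V)" using assms bop_adj unitary_bop by simp
  also have "\<dots> = (adj U \<circ> U) \<circ> V" by (simp only: comp_assoc)
  also have "\<dots> = V" using assms by (simp only: unitary_adj_comp idop_comp)
  finally show ?thesis .
qed

section \<open>Signed permutations of a basis with countable labels\<close>

locale basis_enum =
  fixes \<Omega> :: "'a set"
  assumes countable_\<Omega>: "countable \<Omega>" and infinite_\<Omega>: "infinite \<Omega>"
begin

abbreviation "en \<equiv> from_nat_into \<Omega>"
abbreviation "de \<equiv> to_nat_on \<Omega>"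

definition signed_perm :: "('a \<Rightarrow> complex) \<Rightarrow> ('a \<Rightarrow> 'a) \<Rightarrow> bool" where
  "signed_perm \<sigma> \<Phi> \<longleftrightarrow> bij_betw \<Phi> \<Omega> \<Omega> \<and> (\<forall>\<omega>\<in>\<Omega>. cmod (\<sigma> \<omega>) = 1)"

definition signed_op :: "('a \<Rightarrow> complex) \<Rightarrow> ('a \<Rightarrow> 'a) \<Rightarrow> op" where
  "signed_op \<sigma> \<Phi> = mono_op (\<lambda>n. \<sigma> (en n)) (\<lambda>n. de (\<Phi> (en n)))"

definition delta :: "'a \<Rightarrow> vec" where "delta \<omega> = unitvec (de \<omega>)"

lemma en_in [simp]: "en n \<in> \<Omega>"
  using infinite_\<Omega> by (intro from_nat_into) auto

lemma de_en [simp]: "de (en n) = n"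
  using countable_\<Omega> infinite_\<Omega> by simp

lemma en_de [simp]: "\<omega> \<in> \<Omega> \<Longrightarrow> en (de \<omega>) = \<omega>"
  using countable_\<Omega> by simp

lemma bij_en: "bij_betw en UNIV \<Omega>"
  by (rule bij_betw_from_nat_into[OF countable_\<Omega> infinite_\<Omega>])

lemma bij_de: "bij_betw de \<Omega> UNIV"
  by (rule bij_betw_byWitness[where f' = en]) auto

lemma signed_permD:
  assumes "signed_perm \<sigma> \<Phi>"
  shows "cmod (\<sigma> (en n)) = 1" "bij (\<lambda>n. de (\<Phi> (en n)))"
    and "\<omega> \<in> \<Omega> \<Longrightarrow> \<Phi> \<omega> \<in> \<Omega>"
proof -
  have "bij_betw (de \<circ> (\<Phi> \<circ> en)) UNIV UNIV"
    using assms bij_en bij_de unfolding signed_perm_def by (blast intro: bij_betw_trans)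
  then show "bij (\<lambda>n. de (\<Phi> (en n)))" by (simp add: comp_def)
qed (use assms in \<open>auto simp: signed_perm_def bij_betw_def\<close>)

lemma signed_permI:
  assumes "\<And>\<omega>. \<omega> \<in> \<Omega> \<Longrightarrow> \<Phi> \<omega> \<in> \<Omega>" "\<And>\<omega>. \<omega> \<in> \<Omega> \<Longrightarrow> \<Psi> \<omega> \<in> \<Omega>"
    and "\<And>\<omega>. \<omega> \<in> \<Omega> \<Longrightarrow> \<Psi> (\<Phi> \<omega>) = \<omega>" "\<And>\<omega>. \<omega> \<in> \<Omega> \<Longrightarrow> \<Phi> (\<Psi> \<omega>) = \<omega>"
    and "\<And>\<omega>. \<omega> \<in> \<Omega> \<Longrightarrow> cmod (\<sigma> \<omega>) = 1"
  shows "signed_perm \<sigma> \<Phi>"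
  unfolding signed_perm_def
  using assms by (auto intro!: bij_betw_byWitness[where f' = \<Psi>])

lemma unitary_signed_op: "signed_perm \<sigma> \<Phi> \<Longrightarrow> unitary (signed_op \<sigma> \<Phi>)"
  unfolding signed_op_def by (rule unitary_mono_op) (simp_all add: signed_permD)

lemma bop_signed_op: "signed_perm \<sigma> \<Phi> \<Longrightarrow> bop (signed_op \<sigma> \<Phi>)"
  by (rule unitary_bop[OF unitary_signed_op])

lemma signed_op_cong:
  assumes "\<And>\<omega>. \<omega> \<in> \<Omega> \<Longrightarrow> \<sigma> \<omega> = \<sigma>' \<omega>" "\<And>\<omega>. \<omega> \<in> \<Omega> \<Longrightarrow> \<Phi> \<omega> = \<Phi>' \<omega>"
  shows "signed_op \<sigma> \<Phi> = signed_op \<sigma>' \<Phi>'"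
  unfolding signed_op_def using assms by simp

lemma signed_op_comp:
  assumes "signed_perm \<sigma> \<Phi>" "signed_perm \<sigma>' \<Phi>'"
  shows "signed_op \<sigma> \<Phi> \<circ> signed_op \<sigma>' \<Phi>' = signed_op (\<lambda>\<omega>. \<sigma> \<omega> * \<sigma>' (\<Phi> \<omega>)) (\<lambda>\<omega>. \<Phi>' (\<Phi> \<omega>))"
  unfolding signed_op_def mono_op_comp[of "\<lambda>n. \<sigma>' (en n)", OF signed_permD(1,2)[OF assms(2)]]
  using signed_permD(3)[OF assms(1)] by (simp add: comp_def)

lemma signed_op_commute:
  assumes "signed_perm \<sigma> \<Phi>" "signed_perm \<sigma>' \<Phi>'"
    and "\<And>\<omega>. \<omega> \<in> \<Omega> \<Longrightarrow> \<Phi>' (\<Phi> \<omega>) = \<Phi> (\<Phi>' \<omega>)"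
    and "\<And>\<omega>. \<omega> \<in> \<Omega> \<Longrightarrow> \<sigma> \<omega> * \<sigma>' (\<Phi> \<omega>) = \<sigma>' \<omega> * \<sigma> (\<Phi>' \<omega>)"
  shows "signed_op \<sigma> \<Phi> \<circ> signed_op \<sigma>' \<Phi>' = signed_op \<sigma>' \<Phi>' \<circ> signed_op \<sigma> \<Phi>"
  unfolding signed_op_comp[OF assms(1,2)] signed_op_comp[OF assms(2,1)]
  by (rule signed_op_cong) (use assms(3,4) in auto)

lemma signed_op_one: "signed_op (\<lambda>\<omega>. 1) (\<lambda>\<omega>. \<omega>) = idop"
  unfolding signed_op_def by (simp flip: id_def add: mono_op_id)

lemma signed_op_involution:
  assumes "signed_perm \<sigma> \<Phi>"
    and "\<And>\<omega>. \<omega> \<in> \<Omega> \<Longrightarrow> \<Phi> (\<Phi> \<omega>) = \<omega>" "\<And>\<omega>. \<omega> \<in> \<Omega> \<Longrightarrow> \<sigma> \<omega> * \<sigma> (\<Phi> \<omega>) = 1"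
  shows "signed_op \<sigma> \<Phi> \<circ> signed_op \<sigma> \<Phi> = idop" "adj (signed_op \<sigma> \<Phi>) = signed_op \<sigma> \<Phi>"
proof -
  show 1: "signed_op \<sigma> \<Phi> \<circ> signed_op \<sigma> \<Phi> = idop"
    unfolding signed_op_comp[OF assms(1,1)] signed_op_one[symmetric] by (rule signed_op_cong) (use assms in auto)
  show "adj (signed_op \<sigma> \<Phi>) = signed_op \<sigma> \<Phi>"
    by (rule adj_eq_inverse[OF unitary_signed_op bop_signed_op 1]) (fact assms)+
qed

lemma delta_l2 [simp]: "delta \<omega> \<in> l2"
  by (simp add: delta_def)

lemma hinner_delta [simp]: "hinner (delta \<omega>) x = x (de \<omega>)"
  by (simp add: delta_def)

lemma delta_apply: "\<omega> \<in> \<Omega> \<Longrightarrow> \<omega>' \<in> \<Omega> \<Longrightarrow> delta \<omega> (de \<omega>') = (if \<omega> = \<omega>' then 1 else 0)"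
  by (auto simp: delta_def unitvec_def) (metis en_de)

lemma signed_op_apply: "x \<in> l2 \<Longrightarrow> \<omega> \<in> \<Omega> \<Longrightarrow> signed_op \<sigma> \<Phi> x (de \<omega>) = \<sigma> \<omega> * x (de (\<Phi> \<omega>))"
  by (simp add: signed_op_def mono_op_def)

lemma signed_op_delta:
  assumes "signed_perm \<sigma> \<Phi>" "\<omega> \<in> \<Omega>"
  shows "signed_op \<sigma> \<Phi> (delta (\<Phi> \<omega>)) = vscale (\<sigma> \<omega>) (delta \<omega>)"
  using mono_op_unitvec[OF signed_permD(2)[OF assms(1)], of "\<lambda>n. \<sigma> (en n)" "de \<omega>"] assms(2)
  by (simp add: signed_op_def delta_def)

lemma diag_signed_perm: "signed_perm (\<lambda>\<omega>. if \<omega> \<in> Q then -1 else 1) (\<lambda>\<omega>. \<omega>)"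
  by (rule signed_permI[where \<Psi> = "\<lambda>\<omega>. \<omega>"]) auto

text \<open>The vector \<open>X (delta \<omega>\<^sub>0)\<close> is fixed by the diagonal
  reflection, which negates its coordinates in Q; these equal their own negatives. With Q outside
  the expected support, a claim about supports becomes a claim about commutation.\<close>

lemma vanish_of_commute_diag:
  assumes X: "bop X" "X \<circ> signed_op (\<lambda>\<omega>. if \<omega> \<in> Q then -1 else 1) (\<lambda>\<omega>. \<omega>)
      = signed_op (\<lambda>\<omega>. if \<omega> \<in> Q then -1 else 1) (\<lambda>\<omega>. \<omega>) \<circ> X"
    and \<omega>: "\<omega>\<^sub>0 \<in> \<Omega> - Q" "\<omega> \<in> \<Omega> \<inter> Q"
  shows "X (delta \<omega>\<^sub>0) (de \<omega>) = 0"
proof -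
  let ?D = "signed_op (\<lambda>\<omega>. if \<omega> \<in> Q then -1 else 1) (\<lambda>\<omega>. \<omega>)"
  have "?D (delta \<omega>\<^sub>0) = delta \<omega>\<^sub>0"
    using signed_op_delta[OF diag_signed_perm, of \<omega>\<^sub>0 Q] \<omega> by simp
  then have "X (delta \<omega>\<^sub>0) = ?D (X (delta \<omega>\<^sub>0))"
    using fun_cong[OF X(2), of "delta \<omega>\<^sub>0"] by simp
  then have "X (delta \<omega>\<^sub>0) (de \<omega>) = ?D (X (delta \<omega>\<^sub>0)) (de \<omega>)" by (rule fun_cong)
  also have "\<dots> = - X (delta \<omega>\<^sub>0) (de \<omega>)"
    using \<omega> by (simp add: signed_op_apply bop_l2[OF X(1)])
  finally show ?thesis by simp
qed

lemma hinner_disjoint_support: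
  assumes "\<omega>\<^sub>0 \<in> \<Omega>"
    and "\<And>\<omega>. \<omega> \<in> \<Omega> \<Longrightarrow> \<omega> \<noteq> \<omega>\<^sub>0 \<Longrightarrow> x (de \<omega>) = 0 \<or> y (de \<omega>) = 0"
  shows "hinner x y = cnj (x (de \<omega>\<^sub>0)) * y (de \<omega>\<^sub>0)"
proof -
  have "cnj (x n) * y n = 0" if "n \<noteq> de \<omega>\<^sub>0" for n
    using assms(2)[of "en n"] de_en[of n] that by (cases "en n = \<omega>\<^sub>0") auto
  then have "(\<lambda>n. cnj (x n) * y n) = (\<lambda>n. if n = de \<omega>\<^sub>0 then cnj (x n) * y n else 0)"
    by (auto simp: fun_eq_iff)
  then show ?thesis
    unfolding hinner_def
    using sums_unique[OF sums_single[of "de \<omega>\<^sub>0" "\<lambda>n. cnj (x n) * y n"]] by simp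
qed

end

section \<open>Site permutations and Pauli operators\<close>

definition site_swap :: "nat \<Rightarrow> nat" where
  "site_swap i = (if even i then i + 1 else i - 1)"

text \<open>On residues: 4q and 4q+1 go to 8q and 8q+4, which exhaust the multiples of 4, while 4q+2
  goes to 2q+1 and 4q+3 goes to 4q+2, which exhaust the rest. Each even site and its odd neighbour
  thus land on the type that the even site had.\<close>

definition site_shift :: "nat \<Rightarrow> nat" where
  "site_shift i = (if i mod 4 = 0 then 2 * i else if i mod 4 = 1 then 2 * i + 2
     else if i mod 4 = 2 then i div 2 else i - 1)"

definition site_unshift :: "nat \<Rightarrow> nat" where
  "site_unshift i = (if i mod 8 = 0 then i div 2 else if i mod 8 = 4 then i div 2 - 1
     else if odd i then 2 * i else i + 1)"

lemma site_swap_swap [simp]: "site_swap (site_swap i) = i"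
  by (auto simp: site_swap_def)

lemma site_shift_simps:
  "site_shift (4 * q) = 8 * q" "site_shift (4 * q + 1) = 8 * q + 4"
  "site_shift (4 * q + 2) = 2 * q + 1" "site_shift (4 * q + 3) = 4 * q + 2"
proof -
  have "(4 * q + 1) mod 4 = 1" "(4 * q + 2) mod 4 = 2" "(4 * q + 3) mod 4 = 3"
    "(4 * q + 2) div 2 = 2 * q + 1" by presburger+
  then show "site_shift (4 * q) = 8 * q" "site_shift (4 * q + 1) = 8 * q + 4"
    "site_shift (4 * q + 2) = 2 * q + 1" "site_shift (4 * q + 3) = 4 * q + 2"
    by (simp_all add: site_shift_def)
qed

lemma site_unshift_simps:
  "site_unshift (8 * q) = 4 * q" "site_unshift (8 * q + 4) = 4 * q + 1"
  "site_unshift (2 * q + 1) = 4 * q + 2" "site_unshift (4 * q + 2) = 4 * q + 3"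
proof -
  have "(8 * q + 4) mod 8 = 4" "(8 * q + 4) div 2 = 4 * q + 2" "(8 * q) div 2 = 4 * q"
    "(2 * q + 1) mod 8 \<noteq> 0" "(2 * q + 1) mod 8 \<noteq> 4" "(4 * q + 2) mod 8 \<noteq> 0"
    "(4 * q + 2) mod 8 \<noteq> 4" by presburger+
  then show "site_unshift (8 * q) = 4 * q" "site_unshift (8 * q + 4) = 4 * q + 1"
    "site_unshift (2 * q + 1) = 4 * q + 2" "site_unshift (4 * q + 2) = 4 * q + 3"
    by (simp_all add: site_unshift_def)
qed

lemma site_unshift_shift: "site_unshift (site_shift i) = i"
proof -
  \<comment> \<open>The four residue classes on which the map is affine; its inverse is affine on
    their images, the classes 0 and 4 modulo 8, the odd numbers, and 2 modulo 4.\<close>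
  have "\<exists>q. i = 4 * q \<or> i = 4 * q + 1 \<or> i = 4 * q + 2 \<or> i = 4 * q + 3" by presburger
  then show ?thesis by (elim exE disjE) (simp_all only: site_shift_simps site_unshift_simps)
qed

lemma site_unshift_cases: "\<exists>q. i = 8 * q \<or> i = 8 * q + 4 \<or> i = 2 * q + 1 \<or> i = 4 * q + (2::nat)"
proof (cases "odd i")
  case True then show ?thesis by (metis oddE)
next
  case False
  then obtain k where k: "i = 2 * k" by blast
  show ?thesis
  proof (cases "odd k")
    case True then obtain m where "k = 2 * m + 1" by (rule oddE)
    then have "i = 4 * m + 2" using k by simp
    then show ?thesis by blast
  next
    case False then obtain m where m: "k = 2 * m" by blast
    have "i = 8 * (m div 2) \<or> i = 8 * (m div 2) + 4" using k m by presburger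
    then show ?thesis by blast
  qed
qed

lemma site_shift_unshift: "site_shift (site_unshift i) = i"
  using site_unshift_cases[of i]
  by (elim exE disjE) (simp_all only: site_shift_simps site_unshift_simps)

lemma bij_site_swap: "bij site_swap"
  by (rule o_bij[of site_swap]) (auto simp: fun_eq_iff)

lemma bij_site_shift: "bij site_shift"
  by (rule o_bij[of site_unshift]) (auto simp: fun_eq_iff site_unshift_shift site_shift_unshift)

lemma even_site_swap: "even (site_swap i) \<longleftrightarrow> odd i"
  by (auto simp: site_swap_def)

text \<open>The source of condition (2): even sites keep their entanglement type.\<close>

lemma dvd_site_shift: "even i \<Longrightarrow> 4 dvd site_shift i \<longleftrightarrow> 4 dvd i"
proof -
  assume "even i"
  then have "\<exists>q. i = 4 * q \<or> i = 4 * q + 2" by presburger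
  moreover have "4 dvd 8 * q" "4 dvd 4 * q" "\<not> 4 dvd 2 * q + 1" "\<not> 4 dvd 4 * q + 2" for q :: nat
    by presburger+
  ultimately show ?thesis by (elim exE disjE) (simp_all only: site_shift_simps)
qed

text \<open>The source of condition (3): the odd neighbour acquires the type of the even
  site.\<close>

lemma dvd_site_shift_swap: "even i \<Longrightarrow> 4 dvd site_shift (site_swap i) \<longleftrightarrow> 4 dvd i"
proof -
  assume "even i"
  then have "\<exists>q. i = 4 * q \<or> i = 4 * q + 2" by presburger
  moreover have "4 dvd 8 * q + 4" "4 dvd 4 * q" "\<not> 4 dvd 4 * q + 2" for q :: nat
    by presburger+
  moreover have "site_swap (4 * q) = 4 * q + 1" "site_swap (4 * q + 2) = 4 * q + 3" for q
    by (simp_all add: site_swap_def)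
  ultimately show ?thesis by (elim exE disjE) (simp_all only: site_shift_simps)
qed

text \<open>Taking words in the generators reduces countability of the group to that of lists.
  \<open>site_swap\<close> is its own inverse, so three letters suffice.\<close>

definition site_perms :: "(nat \<Rightarrow> nat) set" where
  "site_perms = (\<lambda>gs. foldr (\<circ>) gs id) ` lists {site_shift, inv site_shift, site_swap}"

lemma countable_site_perms: "countable site_perms"
  unfolding site_perms_def by (intro countable_image countable_lists) simp

lemma id_site_perms: "id \<in> site_perms"
  unfolding site_perms_def by (auto intro!: image_eqI[of _ _ "[]"])

lemma foldr_comp_append: "foldr (\<circ>) (gs @ [g]) id = foldr (\<circ>) gs id \<circ> g"
  by (induction gs) (simp_all add: comp_assoc)

lemma site_perms_comp:
  assumes "f \<in> site_perms" "g \<in> {site_shift, inv site_shift, site_swap}"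
  shows "f \<circ> g \<in> site_perms"
proof -
  obtain gs where gs: "gs \<in> lists {site_shift, inv site_shift, site_swap}" "f = foldr (\<circ>) gs id"
    using assms(1) unfolding site_perms_def by blast
  have "foldr (\<circ>) (gs @ [g]) id \<in> site_perms"
    unfolding site_perms_def by (rule imageI) (use gs assms(2) in simp)
  then show ?thesis unfolding foldr_comp_append gs(2) .
qed

lemma bij_site_perms: assumes "f \<in> site_perms" shows "bij f"
proof -
  obtain gs where gs: "gs \<in> lists {site_shift, inv site_shift, site_swap}" "f = foldr (\<circ>) gs id"
    using assms(1) unfolding site_perms_def by blast
  have "bij (foldr (\<circ>) gs id)"
    using gs(1)
  proof (induction gs)
    case Nil
    show ?case by (metis bij_id foldr_Nil id_apply)
  next
    case (Cons g gs)
    have "bij g"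
      using Cons.hyps bij_site_shift bij_site_swap bij_imp_bij_inv by auto
    then show ?case unfolding foldr_Cons comp_apply[of "(\<circ>) g"] by (rule bij_comp[OF Cons.IH])
  qed
  then show ?thesis unfolding gs(2) .
qed

lemma inv_site_swap: "inv site_swap = site_swap"
  by (rule inv_equality) simp_all

text \<open>In the summand (f, k) the A-qubit of site i acts by left multiplication on the slot (f i, False),
and the B-qubit of site j by right multiplication on the slot (k j, \<not> 4 dvd k j); so two qubits share
a slot exactly if they are entangled. A slot carries the 2x2 matrices with the Hilbert-Schmidt inner
product and the basis X^a Z^b, where a and b record whether the finite set s contains the coordinates
of that slot with third component True and False.\<close>

type_synonym coord = "nat \<times> bool \<times> bool"
type_synonym label = "(nat \<Rightarrow> nat) \<times> (nat \<Rightarrow> nat) \<times> coord set"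

text \<open>Finite s means that all but finitely many slots carry the identity matrix: within a
  summand, this labels a basis of the infinite tensor product of matrix spaces along the identity
  vectors.\<close>

definition \<Omega> :: "label set" where
  "\<Omega> = site_perms \<times> site_perms \<times> {s. finite s}"

lemma countable_labels: "countable \<Omega>"
  unfolding \<Omega>_def by (intro countable_SIGMA countable_site_perms countable_Collect_finite)

lemma infinite_labels: "infinite \<Omega>"
proof -
  define h :: "nat \<Rightarrow> label" where "h n = (id, id, {(n, True, True)})" for n
  have "inj h" by (auto simp: inj_def h_def)
  moreover have "range h \<subseteq> \<Omega>" by (auto simp: \<Omega>_def h_def id_site_perms)
  ultimately show ?thesis using infinite_super range_inj_infinite by blast
qed

interpretation basis_enum \<Omega>
  by unfold_locales (rule countable_labels, rule infinite_labels)

section \<open>Pauli operators as signed flips of exponents\<close>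

definition flip :: "'a \<Rightarrow> 'a set \<Rightarrow> 'a set" where
  "flip c s = (if c \<in> s then s - {c} else insert c s)"

lemma mem_flip [simp]: "d \<in> flip c s \<longleftrightarrow> (if d = c then c \<notin> s else d \<in> s)"
  by (auto simp: flip_def)

lemma finite_flip [simp]: "finite (flip c s) \<longleftrightarrow> finite s"
  by (simp add: flip_def)

lemma flip_flip [simp]: "flip c (flip c s) = s"
  by (auto simp: flip_def)

lemma flip_commute: "flip c (flip d s) = flip d (flip c s)"
  by (auto simp: set_eq_iff)

lemma image_flip: "inj v \<Longrightarrow> v ` flip c s = flip (v c) (v ` s)"
  by (auto simp: flip_def inj_image_mem_iff image_set_diff)

text \<open>\<open>b\<close> is True for X and False for Z. The signs come from Z X = -X Z: on X^a
  Z^b, left multiplication by Z has to pass X^a and right multiplication by X has to pass Z^b, while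
  left X and right Z only change an exponent.\<close>

definition signA :: "nat \<Rightarrow> bool \<Rightarrow> label \<Rightarrow> complex" where
  "signA i b = (\<lambda>(f, k, s). if \<not> b \<and> (f i, False, True) \<in> s then -1 else 1)"
definition flipA :: "nat \<Rightarrow> bool \<Rightarrow> label \<Rightarrow> label" where
  "flipA i b = (\<lambda>(f, k, s). (f, k, flip (f i, False, b) s))"
definition signB :: "nat \<Rightarrow> bool \<Rightarrow> label \<Rightarrow> complex" where
  "signB i b = (\<lambda>(f, k, s). if b \<and> (k i, \<not> 4 dvd k i, False) \<in> s then -1 else 1)"
definition flipB :: "nat \<Rightarrow> bool \<Rightarrow> label \<Rightarrow> label" where
  "flipB i b = (\<lambda>(f, k, s). (f, k, flip (k i, \<not> 4 dvd k i, b) s))"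

definition pauliA :: "nat \<Rightarrow> bool \<Rightarrow> op" where "pauliA i b = signed_op (signA i b) (flipA i b)"
definition pauliB :: "nat \<Rightarrow> bool \<Rightarrow> op" where "pauliB i b = signed_op (signB i b) (flipB i b)"

lemmas pauli_defs = signA_def flipA_def signB_def flipB_def

lemma signed_perm_A: "signed_perm (signA i b) (flipA i b)"
  by (rule signed_permI[where \<Psi> = "flipA i b"]) (auto simp: pauli_defs \<Omega>_def)

lemma signed_perm_B: "signed_perm (signB i b) (flipB i b)"
  by (rule signed_permI[where \<Psi> = "flipB i b"]) (auto simp: pauli_defs \<Omega>_def)

lemma pauliA_involution: "pauliA i b \<circ> pauliA i b = idop" "adj (pauliA i b) = pauliA i b"
  unfolding pauliA_def by (rule signed_op_involution[OF signed_perm_A]; auto simp: pauli_defs)+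

lemma pauliB_involution: "pauliB i b \<circ> pauliB i b = idop" "adj (pauliB i b) = pauliB i b"
  unfolding pauliB_def by (rule signed_op_involution[OF signed_perm_B]; auto simp: pauli_defs)+

lemma unitary_pauli [simp]: "unitary (pauliA i b)" "unitary (pauliB i b)"
  unfolding pauliA_def pauliB_def by (rule unitary_signed_op signed_perm_A signed_perm_B)+

lemma bop_pauli [simp]: "bop (pauliA i b)" "bop (pauliB i b)"
  by (simp_all add: unitary_bop)

lemma site_perms_eq_iff: "f \<in> site_perms \<Longrightarrow> f i = f j \<longleftrightarrow> i = j"
  using bij_is_inj[OF bij_site_perms] by (simp add: inj_eq)

lemma pauliA_commute: "i \<noteq> j \<Longrightarrow> pauliA i b \<circ> pauliA j c = pauliA j c \<circ> pauliA i b"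
  unfolding pauliA_def
  by (rule signed_op_commute[OF signed_perm_A signed_perm_A])
     (auto simp: pauli_defs \<Omega>_def flip_commute site_perms_eq_iff)

lemma pauliB_commute: "i \<noteq> j \<Longrightarrow> pauliB i b \<circ> pauliB j c = pauliB j c \<circ> pauliB i b"
  unfolding pauliB_def
  by (rule signed_op_commute[OF signed_perm_B signed_perm_B])
     (auto simp: pauli_defs \<Omega>_def flip_commute site_perms_eq_iff)

text \<open>Left and right multiplications commute even on a shared slot. The one delicate case is
  left Z with right X: each flips the coordinate that decides the sign of the other, so both orders
  pick up the same extra -1.\<close>

lemma pauliA_pauliB_commute: "pauliA i b \<circ> pauliB j c = pauliB j c \<circ> pauliA i b"
  unfolding pauliA_def pauliB_def
  by (rule signed_op_commute[OF signed_perm_A signed_perm_B])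
     (auto simp: pauli_defs \<Omega>_def flip_commute split: if_splits)

lemma pauliB_anticommute:
  "pauliB i True \<circ> pauliB i False = opscale (-1) (pauliB i False \<circ> pauliB i True)"
proof -
  have "opscale (-1) (signed_op \<sigma> \<Phi>) = signed_op (\<lambda>\<omega>. - \<sigma> \<omega>) \<Phi>" for \<sigma> \<Phi>
    by (auto simp: opscale_def signed_op_def mono_op_def fun_eq_iff)
  then show ?thesis
    unfolding pauliB_def signed_op_comp[OF signed_perm_B signed_perm_B]
    by simp (rule signed_op_cong, auto simp: pauli_defs flip_commute)
qed

text \<open>As \<open>signed_op\<close> pulls labels back, the inverse here makes the basis vector
  of (f, k, s) go to that of (f o g, k, s), and conjugation sends the Pauli operators of site i to
  those of site g i.\<close>

definition relabelA :: "(nat \<Rightarrow> nat) \<Rightarrow> op" where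
  "relabelA g = signed_op (\<lambda>_. 1) (\<lambda>(f, k, s). (f \<circ> inv g, k, s))"
definition relabelB :: "(nat \<Rightarrow> nat) \<Rightarrow> op" where
  "relabelB g = signed_op (\<lambda>_. 1) (\<lambda>(f, k, s). (f, k \<circ> inv g, s))"

definition site_moves :: "(nat \<Rightarrow> nat) set" where "site_moves = {site_shift, site_swap}"

lemma site_movesD:
  assumes "g \<in> site_moves"
  shows "bij g" "f \<in> site_perms \<Longrightarrow> f \<circ> g \<in> site_perms" "f \<in> site_perms \<Longrightarrow> f \<circ> inv g \<in> site_perms"
  using assms site_perms_comp bij_site_shift bij_site_swap by (auto simp: site_moves_def inv_site_swap)

lemma comp_inv_cancel: "bij g \<Longrightarrow> f \<circ> g \<circ> inv g = f" "bij g \<Longrightarrow> f \<circ> inv g \<circ> g = f"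
  by (simp_all add: fun_eq_iff bij_is_inj bij_is_surj surj_f_inv_f)

lemma signed_perm_relabelA:
  assumes "g \<in> site_moves" shows "signed_perm (\<lambda>_. 1) (\<lambda>(f, k, s). (f \<circ> inv g, k, s))"
proof (rule signed_permI[where \<Psi> = "\<lambda>(f, k, s). (f \<circ> g, k, s)"], goal_cases)
  case (1 \<omega>) then show ?case using site_movesD(3)[OF assms] by (cases \<omega>) (simp add: \<Omega>_def)
next
  case (2 \<omega>) then show ?case using site_movesD(2)[OF assms] by (cases \<omega>) (simp add: \<Omega>_def)
qed (auto simp: comp_inv_cancel[OF site_movesD(1)[OF assms]])

lemma signed_perm_relabelB:
  assumes "g \<in> site_moves" shows "signed_perm (\<lambda>_. 1) (\<lambda>(f, k, s). (f, k \<circ> inv g, s))"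
proof (rule signed_permI[where \<Psi> = "\<lambda>(f, k, s). (f, k \<circ> g, s)"], goal_cases)
  case (1 \<omega>) then show ?case using site_movesD(3)[OF assms] by (cases \<omega>) (simp add: \<Omega>_def)
next
  case (2 \<omega>) then show ?case using site_movesD(2)[OF assms] by (cases \<omega>) (simp add: \<Omega>_def)
qed (auto simp: comp_inv_cancel[OF site_movesD(1)[OF assms]])

lemma unitary_relabel: "g \<in> site_moves \<Longrightarrow> unitary (relabelA g)" "g \<in> site_moves \<Longrightarrow> unitary (relabelB g)"
  by (unfold relabelA_def relabelB_def, erule unitary_signed_op[OF signed_perm_relabelA],
      erule unitary_signed_op[OF signed_perm_relabelB])

lemma inv_apply_bij: "bij g \<Longrightarrow> inv g (g i) = i"
  by (simp add: bij_is_inj)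

lemma relabelA_commute_B: "g \<in> site_moves \<Longrightarrow> pauliB i b \<circ> relabelA g = relabelA g \<circ> pauliB i b"
  unfolding pauliB_def relabelA_def
  by (rule signed_op_commute[OF signed_perm_B signed_perm_relabelA]) (auto simp: pauli_defs)

lemma relabelB_commute_A: "g \<in> site_moves \<Longrightarrow> pauliA i b \<circ> relabelB g = relabelB g \<circ> pauliA i b"
  unfolding pauliA_def relabelB_def
  by (rule signed_op_commute[OF signed_perm_A signed_perm_relabelB]) (auto simp: pauli_defs)

lemma relabelA_relabelB_commute:
  "g \<in> site_moves \<Longrightarrow> h \<in> site_moves \<Longrightarrow> relabelA g \<circ> relabelB h = relabelB h \<circ> relabelA g"
  unfolding relabelA_def relabelB_def
  by (rule signed_op_commute[OF signed_perm_relabelA signed_perm_relabelB]) auto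

lemma conjop_eqI:
  assumes "unitary U" "bop S" "T \<circ> U = U \<circ> S" shows "conjop U T = S"
proof -
  have "conjop U T = (adj U \<circ> U) \<circ> S" using assms(3) by (simp add: conjop_def comp_assoc)
  then show ?thesis using assms by (simp only: unitary_adj_comp idop_comp)
qed

lemma conjop_relabelA:
  assumes "g \<in> site_moves" shows "conjop (relabelA g) (pauliA i b) = pauliA (g i) b"
proof (rule conjop_eqI[OF unitary_relabel(1)[OF assms]])
  show "pauliA i b \<circ> relabelA g = relabelA g \<circ> pauliA (g i) b"
    unfolding pauliA_def relabelA_def signed_op_comp[OF signed_perm_A signed_perm_relabelA[OF assms]]
      signed_op_comp[OF signed_perm_relabelA[OF assms] signed_perm_A]
    by (rule signed_op_cong) (auto simp: pauli_defs inv_apply_bij site_movesD[OF assms])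
qed simp

lemma conjop_relabelB:
  assumes "g \<in> site_moves" shows "conjop (relabelB g) (pauliB i b) = pauliB (g i) b"
proof (rule conjop_eqI[OF unitary_relabel(2)[OF assms]])
  show "pauliB i b \<circ> relabelB g = relabelB g \<circ> pauliB (g i) b"
    unfolding pauliB_def relabelB_def signed_op_comp[OF signed_perm_B signed_perm_relabelB[OF assms]]
      signed_op_comp[OF signed_perm_relabelB[OF assms] signed_perm_B]
    by (rule signed_op_cong) (auto simp: pauli_defs inv_apply_bij site_movesD[OF assms])
qed simp

text \<open>When both parties apply the same g, the state stays in the diagonal summands with empty
  label. Comparing states before and after therefore amounts to comparing diagonal summands.\<close>

lemma relabel_delta:
  assumes g: "g \<in> site_moves" and f: "f \<in> site_perms"
  shows "relabelA g (relabelB g (delta (f, f, {}))) = delta (f \<circ> g, f \<circ> g, {})"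
proof -
  have fg: "f \<circ> g \<in> site_perms" "f \<circ> g \<circ> inv g = f"
    using site_movesD[OF g] f by (simp_all add: comp_inv_cancel)
  have "relabelB g (delta (f, f, {})) = delta (f, f \<circ> g, {})"
    unfolding relabelB_def
    using signed_op_delta[OF signed_perm_relabelB[OF g], of "(f, f \<circ> g, {})"] f fg by (simp add: \<Omega>_def)
  moreover have "relabelA g (delta (f, f \<circ> g, {})) = delta (f \<circ> g, f \<circ> g, {})"
    unfolding relabelA_def
    using signed_op_delta[OF signed_perm_relabelA[OF g], of "(f \<circ> g, f \<circ> g, {})"] f fg by (simp add: \<Omega>_def)
  ultimately show ?thesis by simp
qed

section \<open>The register algebras and their states\<close>

definition genA :: "nat set \<Rightarrow> op set" where "genA I = {pauliA i b |i b. i \<in> I}"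
definition genB :: "nat set \<Rightarrow> op set" where "genB I = {pauliB i b |i b. i \<in> I}"

lemma bop_gen: "s \<in> genA I \<union> genB J \<Longrightarrow> bop s"
  by (auto simp: genA_def genB_def)

lemma cstar_gen_AB: "unital_cstar_subalg (cstar_gen (genA I \<union> genB J))"
  by (rule cstar_gen_cstar) (rule bop_gen)

definition algA :: "nat set \<Rightarrow> op set" where "algA I = cstar_gen (genA I)"
definition algB :: "nat set \<Rightarrow> op set" where "algB I = cstar_gen (genB I)"

text \<open>Presents the algebra of one party as the two-party case with an empty site set, so that
  facts proved for both parties cover it.\<close>

lemma gen_Un_empty: "genA I = genA I \<union> genB {}" "genB J = genA {} \<union> genB J"
  by (auto simp: genA_def genB_def)

lemma algA_cstar: "unital_cstar_subalg (algA I)"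
  unfolding algA_def by (subst gen_Un_empty(1)) (rule cstar_gen_AB)

lemma algB_cstar: "unital_cstar_subalg (algB J)"
  unfolding algB_def by (subst gen_Un_empty(2)) (rule cstar_gen_AB)

lemma algs_sub: "algA I \<subseteq> cstar_gen (genA I \<union> genB J)" "algB J \<subseteq> cstar_gen (genA I \<union> genB J)"
  unfolding algA_def algB_def by (rule cstar_gen_mono; blast)+

lemma commute_algA_algA: "I \<inter> J = {} \<Longrightarrow> commute_algs (algA I) (algA J)"
  unfolding algA_def
  by (rule commute_algs_cstar_gen)
     (auto simp: genA_def pauliA_involution intro!: pauliA_commute)

lemma commute_algB_algB: "I \<inter> J = {} \<Longrightarrow> commute_algs (algB I) (algB J)"
  unfolding algB_def
  by (rule commute_algs_cstar_gen)
     (auto simp: genB_def pauliB_involution intro!: pauliB_commute)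

lemma commute_algA_algB: "commute_algs (algA I) (algB J)"
  unfolding algA_def algB_def
  by (rule commute_algs_cstar_gen)
     (auto simp: genA_def genB_def pauliA_involution pauliB_involution intro!: pauliA_pauliB_commute)

lemma commute_algs_sym: "commute_algs A B \<Longrightarrow> commute_algs B A"
  by (simp add: commute_algs_def)

lemma commute_with_unitary:
  assumes "unitary U" "bop a" "a \<circ> U = U \<circ> a" shows "a \<circ> adj U = adj U \<circ> a"
proof -
  have "a \<circ> adj U = (adj U \<circ> U) \<circ> a \<circ> adj U"
    using assms(1,2) by (simp only: unitary_adj_comp idop_comp)
  also have "\<dots> = adj U \<circ> (U \<circ> a) \<circ> adj U" by (simp only: comp_assoc)
  also have "\<dots> = adj U \<circ> a \<circ> (U \<circ> adj U)" unfolding assms(3)[symmetric] by (simp only: comp_assoc)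
  also have "\<dots> = adj U \<circ> a"
    using assms(1,2) by (simp only: unitary_comp_adj idop_comp bop_comp bop_adj unitary_bop)
  finally show ?thesis .
qed

text \<open>For a unitary the adjoint is the inverse, so commuting with U already entails the
  adjoint half of the commutant condition.\<close>

lemma cstar_gen_commute_unitary:
  assumes "unitary U" "\<And>s. s \<in> S \<Longrightarrow> bop s" "\<And>s. s \<in> S \<Longrightarrow> s \<circ> U = U \<circ> s" "T \<in> cstar_gen S"
  shows "T \<circ> U = U \<circ> T"
  by (rule cstar_gen_commute[OF assms(2) unitary_bop[OF assms(1)] assms(3) _ assms(4)])
     (auto intro: commute_with_unitary assms)

lemma conjop_genA: "g \<in> site_moves \<Longrightarrow> conjop (relabelA g) ` genA I = genA (g ` I)"
  by (auto simp: genA_def image_iff conjop_relabelA) (metis conjop_relabelA)+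

lemma conjop_genB: "g \<in> site_moves \<Longrightarrow> conjop (relabelB g) ` genB I = genB (g ` I)"
  by (auto simp: genB_def image_iff conjop_relabelB) (metis conjop_relabelB)+

lemma conjop_algA:
  assumes "g \<in> site_moves" shows "conjop (relabelA g) ` algA I = algA (g ` I)"
  unfolding algA_def conjop_genA[OF assms, symmetric]
  by (rule conjop_cstar_gen[OF unitary_relabel(1)[OF assms]]) (auto simp: genA_def)

lemma conjop_algB:
  assumes "g \<in> site_moves" shows "conjop (relabelB g) ` algB I = algB (g ` I)"
  unfolding algB_def conjop_genB[OF assms, symmetric]
  by (rule conjop_cstar_gen[OF unitary_relabel(2)[OF assms]]) (auto simp: genB_def)

lemma algB_commute_relabelA: "g \<in> site_moves \<Longrightarrow> T \<in> algB J \<Longrightarrow> T \<circ> relabelA g = relabelA g \<circ> T"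
  unfolding algB_def
  by (erule cstar_gen_commute_unitary[OF unitary_relabel(1), rotated -1])
     (auto simp: genB_def relabelA_commute_B)

lemma algA_commute_relabelB: "g \<in> site_moves \<Longrightarrow> T \<in> algA I \<Longrightarrow> T \<circ> relabelB g = relabelB g \<circ> T"
  unfolding algA_def
  by (erule cstar_gen_commute_unitary[OF unitary_relabel(2), rotated -1])
     (auto simp: genA_def relabelB_commute_A)

lemma algA_Un: "cstar_gen (\<Union>{algA I, algA J}) = algA (I \<union> J)"
  unfolding algA_def by (simp add: cstar_gen_Un_gen) (rule arg_cong[of _ _ cstar_gen], auto simp: genA_def)

lemma algB_Un: "cstar_gen (\<Union>{algB I, algB J}) = algB (I \<union> J)"
  unfolding algB_def by (simp add: cstar_gen_Un_gen) (rule arg_cong[of _ _ cstar_gen], auto simp: genB_def)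

text \<open>Conjugation moves the algebra of a site set to that of its image, and g maps all sites
  onto all sites.\<close>

lemma acts_on_relabelA:
  assumes "g \<in> site_moves" "I \<union> J = UNIV"
  shows "acts_on (relabelA g) {algB K, algB L} {algA I, algA J}"
  unfolding acts_on_def algA_Un assms(2) conjop_algA[OF assms(1)]
  using assms(1) site_movesD(1)[OF assms(1)]
  by (auto simp: bij_is_surj intro!: conjop_id unitary_relabel algB_commute_relabelA
      intro: cstar_bop[OF algB_cstar])

lemma acts_on_relabelB:
  assumes "g \<in> site_moves" "I \<union> J = UNIV"
  shows "acts_on (relabelB g) {algA K, algA L} {algB I, algB J}"
  unfolding acts_on_def algB_Un assms(2) conjop_algB[OF assms(1)]
  using assms(1) site_movesD(1)[OF assms(1)]
  by (auto simp: bij_is_surj intro!: conjop_id unitary_relabel algA_commute_relabelB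
      intro: cstar_bop[OF algA_cstar])

section \<open>Locality of the operators of a set of sites\<close>

abbreviation vac :: vec where "vac \<equiv> delta (id, id, {})"

text \<open>The exponents that operators at these sites can change in the summand (id, id).\<close>

definition coords :: "nat set \<Rightarrow> nat set \<Rightarrow> coord set" where
  "coords I J = {(i, False, b) |i b. i \<in> I} \<union> {(i, \<not> 4 dvd i, b) |i b. i \<in> J}"

lemma label_in [simp]: "(id, id, {}) \<in> \<Omega>"
  by (simp add: \<Omega>_def id_site_perms)

lemma vac_support:
  assumes X: "X \<in> cstar_gen (genA I \<union> genB J)" and \<omega>: "(f, k, s) \<in> \<Omega>"
    and nz: "X vac (de (f, k, s)) \<noteq> 0"
  shows "f = id" "k = id" "s \<subseteq> coords I J"
proof -
  let ?D = "\<lambda>Q. signed_op (\<lambda>\<omega>. if \<omega> \<in> Q then -1 else 1) (\<lambda>\<omega>. \<omega>)"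
  \<comment> \<open>A set Q of labels that no generator enters or leaves gives a diagonal reflection
    commuting with X. If Q misses the label of \<open>vac\<close>, then \<open>X vac\<close>
    vanishes on Q.\<close>
  have comm: "(f, k, s) \<notin> Q"
    if Q: "\<And>i b \<omega>. i \<in> I \<Longrightarrow> flipA i b \<omega> \<in> Q \<longleftrightarrow> \<omega> \<in> Q"
      "\<And>i b \<omega>. i \<in> J \<Longrightarrow> flipB i b \<omega> \<in> Q \<longleftrightarrow> \<omega> \<in> Q" "(id, id, {}) \<notin> Q" for Q
  proof
    assume "(f, k, s) \<in> Q"
    have A: "pauliA i b \<circ> ?D Q = ?D Q \<circ> pauliA i b" if "i \<in> I" for i b
      unfolding pauliA_def
      by (rule signed_op_commute[OF signed_perm_A diag_signed_perm]) (simp_all add: Q that)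
    have B: "pauliB i b \<circ> ?D Q = ?D Q \<circ> pauliB i b" if "i \<in> J" for i b
      unfolding pauliB_def
      by (rule signed_op_commute[OF signed_perm_B diag_signed_perm]) (simp_all add: Q that)
    have "X \<circ> ?D Q = ?D Q \<circ> X"
      by (rule cstar_gen_commute_unitary[OF unitary_signed_op[OF diag_signed_perm] bop_gen _ X])
         (auto simp: genA_def genB_def A B)
    then have "X vac (de (f, k, s)) = 0"
      using vanish_of_commute_diag[of X Q "(id, id, {})" "(f, k, s)"] cstar_bop[OF cstar_gen_AB X] \<omega>
        \<open>(f, k, s) \<in> Q\<close> Q(3) by simp
    then show False using nz by simp
  qed
  show f: "f = id" using comm[of "{(f, k, s). f \<noteq> id}"] by (simp add: pauli_defs split: prod.splits)
  show k: "k = id" using comm[of "{(f, k, s). k \<noteq> id}"] by (simp add: pauli_defs split: prod.splits)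
  show "s \<subseteq> coords I J"
  proof
    fix c assume "c \<in> s"
    show "c \<in> coords I J"
    proof (rule ccontr)
      assume c: "c \<notin> coords I J"
      \<comment> \<open>Q has to be confined to the summand (id, id): elsewhere the generators flip
        coordinates at f i or k i, which \<open>coords\<close> does not describe.\<close>
      have "(f, k, s) \<notin> {(f, k, s). f = id \<and> k = id \<and> c \<in> s}"
      proof (rule comm)
        fix i b and \<omega> :: label
        assume "i \<in> I"
        then have "c \<noteq> (i, False, b)" using c by (auto simp: coords_def)
        then show "flipA i b \<omega> \<in> {(f, k, s). f = id \<and> k = id \<and> c \<in> s}
            \<longleftrightarrow> \<omega> \<in> {(f, k, s). f = id \<and> k = id \<and> c \<in> s}"
          by (cases \<omega>) (auto simp: flipA_def)
      next
        fix i b and \<omega> :: label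
        assume "i \<in> J"
        then have "c \<noteq> (i, \<not> 4 dvd i, b)" using c unfolding coords_def by blast
        then show "flipB i b \<omega> \<in> {(f, k, s). f = id \<and> k = id \<and> c \<in> s}
            \<longleftrightarrow> \<omega> \<in> {(f, k, s). f = id \<and> k = id \<and> c \<in> s}"
          by (cases \<omega>) (auto simp: flipB_def)
      qed simp
      then show False using f k \<open>c \<in> s\<close> by simp
    qed
  qed
qed

text \<open>Write the left side as <X* vac, Y vac>. Both vectors are supported in the summand (id,
  id) on subsets of disjoint coordinate sets, so the only label they can share is that of
  \<open>vac\<close>, and the inner product is a single term.\<close>

lemma vac_product:
  assumes X: "X \<in> cstar_gen (genA I \<union> genB J)" and Y: "Y \<in> cstar_gen (genA I' \<union> genB J')"
    and disj: "coords I J \<inter> coords I' J' = {}"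
  shows "hinner vac (X (Y vac)) = hinner vac (X vac) * hinner vac (Y vac)"
proof -
  have bX: "bop X" and bY: "bop Y" using cstar_bop[OF cstar_gen_AB] X Y by auto
  have X': "adj X \<in> cstar_gen (genA I \<union> genB J)" by (rule cstar_adj[OF cstar_gen_AB X])
  have "hinner vac (X (Y vac)) = hinner (adj X vac) (Y vac)"
    using bX bY by (simp only: hinner_adj_left bop_l2 delta_l2)
  also have "\<dots> = cnj (adj X vac (de (id, id, {}))) * Y vac (de (id, id, {}))"
  proof (rule hinner_disjoint_support[OF label_in])
    fix \<omega> assume \<omega>: "\<omega> \<in> \<Omega>" "\<omega> \<noteq> (id, id, {})"
    obtain f k s where w: "\<omega> = (f, k, s)" by (metis prod.collapse)
    show "adj X vac (de \<omega>) = 0 \<or> Y vac (de \<omega>) = 0"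
      using vac_support[OF X', of f k s] vac_support[OF Y, of f k s] \<omega> w disj by auto
  qed
  also have "cnj (adj X vac (de (id, id, {}))) = cnj (hinner vac (adj X vac))" by simp
  also have "\<dots> = hinner (adj X vac) vac"
    by (rule hinner_cnj[OF delta_l2 bop_l2[OF bop_adj[OF bX]]])
  also have "\<dots> = hinner vac (X vac)" by (rule hinner_adj_left[OF bX delta_l2 delta_l2])
  finally show ?thesis by (simp only: hinner_delta)
qed

section \<open>Comparison of the diagonal summands with the initial one\<close>

definition vmap :: "(nat \<Rightarrow> nat) \<Rightarrow> coord \<Rightarrow> coord" where
  "vmap g = (\<lambda>(i, r). (g i, r))"

lemma inj_vmap: "inj g \<Longrightarrow> inj (vmap g)"
  by (auto simp: inj_def vmap_def)

lemma vmap_inv: "bij g \<Longrightarrow> vmap g ` vmap (inv g) ` s = s" "bij g \<Longrightarrow> vmap (inv g) ` vmap g ` s = s"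
  by (simp_all add: image_image vmap_def case_prod_unfold bij_is_inj bij_is_surj surj_f_inv_f)

text \<open>Identifies the summand (id, id) with the summand (g, g), where site i plays the role of g i. It
commutes with the operators of all sites whose entanglement type g preserves.\<close>

definition sector_swap :: "(nat \<Rightarrow> nat) \<Rightarrow> label \<Rightarrow> label" where
  "sector_swap g = (\<lambda>(f, k, s).
     if f = id \<and> k = id then (g, g, vmap g ` s)
     else if f = g \<and> k = g then (id, id, vmap (inv g) ` s) else (f, k, s))"

lemma signed_perm_sector_swap:
  assumes g: "g \<in> site_perms" "g \<noteq> id"
  shows "signed_perm (\<lambda>_. 1) (sector_swap g)"
proof -
  have inv: "sector_swap g (sector_swap g \<omega>) = \<omega>" for \<omega>
    using g(2) vmap_inv[OF bij_site_perms[OF g(1)]] by (cases \<omega>) (auto simp: sector_swap_def)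
  have "sector_swap g \<omega> \<in> \<Omega>" if "\<omega> \<in> \<Omega>" for \<omega>
    using that g(1) id_site_perms by (cases \<omega>) (auto simp: sector_swap_def \<Omega>_def)
  then show ?thesis
    by (intro signed_permI[where \<Psi> = "sector_swap g"]) (simp_all add: inv)
qed

text \<open>The swap of the two summands is a unitary carrying \<open>vac\<close> to the empty label
  of (g, g), and it commutes with X. For A-operators this holds at every site. The slot of a
  B-operator also records divisibility by 4, so there g must preserve the type of the site, which is
  the assumption on I.\<close>

lemma sector_state:
  assumes g: "g \<in> site_perms" "g \<noteq> id" and I: "\<And>i. i \<in> I \<Longrightarrow> 4 dvd g i \<longleftrightarrow> 4 dvd i"
    and X: "X \<in> cstar_gen (genA I \<union> genB I)"
  shows "hinner (delta (g, g, {})) (X (delta (g, g, {}))) = hinner vac (X vac)"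
proof -
  note sw = signed_perm_sector_swap[OF g]
  let ?R = "signed_op (\<lambda>_. 1) (sector_swap g)"
  have bij: "bij g" by (rule bij_site_perms[OF g(1)])
  note inj = bij_is_inj[OF bij] bij_is_inj[OF bij_imp_bij_inv[OF bij]]
  have v: "vmap g (i, r) = (g i, r)" "vmap (inv g) (g i, r) = (i, r)" for i r
    using inj by (simp_all add: vmap_def)
  have mem: "(g i, r) \<in> vmap g ` s \<longleftrightarrow> (i, r) \<in> s"
    "(i, r) \<in> vmap (inv g) ` s \<longleftrightarrow> (g i, r) \<in> s" for i r s
    using inj_image_mem_iff[OF inj_vmap[OF inj(1)], of "(i, r)" s]
      inj_image_mem_iff[OF inj_vmap[OF inj(2)], of "(g i, r)" s] by (simp_all add: v)
  have fl: "vmap g ` flip (i, r) s = flip (g i, r) (vmap g ` s)"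
    "vmap (inv g) ` flip (g i, r) s = flip (i, r) (vmap (inv g) ` s)" for i r s
    using image_flip[OF inj_vmap[OF inj(1)], of "(i, r)" s]
      image_flip[OF inj_vmap[OF inj(2)], of "(g i, r)" s] by (simp_all add: v)
  have A: "sector_swap g (flipA i b \<omega>) = flipA i b (sector_swap g \<omega>)"
    "signA i b (sector_swap g \<omega>) = signA i b \<omega>" for i b \<omega>
    using g(2) by (cases \<omega>; auto simp: sector_swap_def pauli_defs mem fl)+
  have B: "sector_swap g (flipB i b \<omega>) = flipB i b (sector_swap g \<omega>)"
    "signB i b (sector_swap g \<omega>) = signB i b \<omega>" if "i \<in> I" for i b \<omega>
    using g(2) I[OF that] by (cases \<omega>; auto simp: sector_swap_def pauli_defs mem fl)+
  have cA: "pauliA i b \<circ> ?R = ?R \<circ> pauliA i b" for i b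
    unfolding pauliA_def by (rule signed_op_commute[OF signed_perm_A sw]) (simp_all add: A)
  have cB: "pauliB i b \<circ> ?R = ?R \<circ> pauliB i b" if "i \<in> I" for i b
    unfolding pauliB_def by (rule signed_op_commute[OF signed_perm_B sw]) (simp_all add: B that)
  have comm: "X \<circ> ?R = ?R \<circ> X"
    by (rule cstar_gen_commute_unitary[OF unitary_signed_op[OF sw] bop_gen _ X])
       (auto simp: genA_def genB_def cA cB)
  have R: "?R vac = delta (g, g, {})"
    using signed_op_delta[OF sw, of "(g, g, {})"] g by (simp add: sector_swap_def \<Omega>_def)
  have "hinner (?R vac) (X (?R vac)) = hinner (?R vac) (?R (X vac))"
    using fun_cong[OF comm, of vac] by simp
  also have "\<dots> = hinner vac (X vac)"
    by (rule unitary_hinner[OF unitary_signed_op[OF sw] delta_l2 bop_l2[OF cstar_bop[OF cstar_gen_AB X]]])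
  finally show ?thesis unfolding R .
qed

section \<open>Exact self-embezzlement\<close>

text \<open>In (S + T)^2 the cross terms cancel and 2 remains, so M is a self-adjoint involution,
  hence unitary.\<close>

lemma anticommuting_involutions_mean:
  assumes S: "bop S" "adj S = S" "S \<circ> S = idop" and T: "bop T" "adj T = T" "T \<circ> T = idop"
    and anti: "S \<circ> T = opscale (-1) (T \<circ> S)"
  defines "M \<equiv> opscale (complex_of_real (1 / sqrt 2)) (opadd S T)"
  shows "bop M" "adj M = M" "opnorm M \<le> 1"
proof -
  show M: "bop M" unfolding M_def using S T by (intro bop_opscale bop_opadd)
  show adj: "adj M = M"
    unfolding M_def using S T by (simp add: adj_opscale adj_opadd bop_opadd)
  have "opadd S T \<circ> opadd S T = opadd (opadd (S \<circ> S) (S \<circ> T)) (opadd (T \<circ> S) (T \<circ> T))"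
    using S T
    by (simp only: opadd_comp comp_opadd)
  also have "\<dots> = opscale 2 idop"
    unfolding S(3) T(3) anti by (simp add: opadd_def opscale_def fun_eq_iff)
  finally have sq: "opadd S T \<circ> opadd S T = opscale 2 idop" .
  have "M \<circ> M = opscale (complex_of_real (1 / sqrt 2))
      (opscale (complex_of_real (1 / sqrt 2)) (opadd S T \<circ> opadd S T))"
    unfolding M_def using S T by (simp only: opscale_comp comp_opscale bop_opadd)
  also have "\<dots> = idop"
  proof -
    have "complex_of_real (1 / sqrt 2) * (complex_of_real (1 / sqrt 2) * (2 * z)) = z" for z
    proof -
      have "complex_of_real (1 / sqrt 2) * complex_of_real (1 / sqrt 2) = 1 / 2"
        by (simp flip: of_real_mult)
      then show ?thesis by (simp add: mult.assoc[symmetric])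
    qed
    then show ?thesis unfolding sq by (simp only: opscale_def)
  qed
  finally have "unitary M" using M adj by (simp add: unitary_def)
  then show "opnorm M \<le> 1" by (rule opnorm_unitary_le)
qed

text \<open>The normalised trace of a product of two of X and Z. Site 0 serves because 4 divides 0:
  both parties act there on the slot (0, False).\<close>

lemma pauli_correlation:
  "hinner vac (pauliA 0 b (pauliB 0 c vac)) = (if b = c then 1 else 0)"
proof -
  have in\<Omega>: "(id, id, s) \<in> \<Omega>" if "finite s" for s
    using that by (simp add: \<Omega>_def id_site_perms)
  have "pauliA 0 b (pauliB 0 c vac) (de (id, id, {})) = pauliB 0 c vac (de (id, id, {(0, False, b)}))"
    unfolding pauliA_def
    by (subst signed_op_apply) (use in\<Omega>[of "{}"] bop_l2[OF bop_pauli(2)] in \<open>simp_all add: pauli_defs flip_def\<close>)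
  also have "\<dots> = (if c \<and> \<not> b then -1 else 1) * vac (de (id, id, flip (0, False, c) {(0, False, b)}))"
    unfolding pauliB_def
    by (subst signed_op_apply) (use in\<Omega>[of "{(0, False, b)}"] in \<open>simp_all add: pauli_defs\<close>)
  also have "\<dots> = (if b = c then 1 else 0)"
    by (subst delta_apply[OF in\<Omega> in\<Omega>]) (auto simp: flip_def)
  finally show ?thesis by simp
qed

lemma vac_norm: "hnorm vac = 1"
proof -
  have "complex_of_real ((hnorm vac)\<^sup>2) = 1"
    unfolding hinner_self[OF delta_l2, symmetric] hinner_delta delta_apply[OF label_in label_in] by simp
  then have "(hnorm vac)\<^sup>2 = 1" by (simp only: of_real_eq_1_iff)
  then show ?thesis
    using power2_eq_imp_eq[of "hnorm vac" 1] hnorm_nonneg[OF delta_l2] by simp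
qed

text \<open>The standard optimal observables on the pair at site 0: X and Z for A, (X + Z)/sqrt 2
  and (X - Z)/sqrt 2 for B. Each of the four terms contributes 1/sqrt 2 with its sign.\<close>

lemma CHSH_maximal:
  "\<exists>a0 a1 b0 b1.
     a0 \<in> algA {i. even i} \<and> a1 \<in> algA {i. even i} \<and> b0 \<in> algB {i. even i} \<and> b1 \<in> algB {i. even i} \<and>
     adj a0 = a0 \<and> adj a1 = a1 \<and> adj b0 = b0 \<and> adj b1 = b1 \<and>
     opnorm a0 \<le> 1 \<and> opnorm a1 \<le> 1 \<and> opnorm b0 \<le> 1 \<and> opnorm b1 \<le> 1 \<and>
     hinner vac (a0 (b0 vac)) + hinner vac (a0 (b1 vac)) + hinner vac (a1 (b0 vac))
       - hinner vac (a1 (b1 vac)) = complex_of_real (2 * sqrt 2)"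
proof -
  let ?S = "pauliB 0 True" and ?T = "pauliB 0 False"
  let ?r = "complex_of_real (1 / sqrt 2)"
  let ?N = "opscale (-1) ?T"
  define b0 where "b0 = opscale ?r (opadd ?S ?T)"
  define b1 where "b1 = opscale ?r (opadd ?S ?N)"
  \<comment> \<open>-Z is again a self-adjoint involution anticommuting with X, so the argument for
    b0 also applies to b1.\<close>
  have N: "bop ?N" "adj ?N = ?N" "?N \<circ> ?N = idop" "?S \<circ> ?N = opscale (-1) (?N \<circ> ?S)"
  proof -
    show "bop ?N" by (rule bop_opscale) simp
    show "adj ?N = ?N" by (simp add: adj_opscale pauliB_involution)
    have "opscale (-1) (opscale (-1) R) = R" for R by (simp add: opscale_def)
    then show "?N \<circ> ?N = idop"
      by (simp only: opscale_comp comp_opscale bop_pauli pauliB_involution)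
    show "?S \<circ> ?N = opscale (-1) (?N \<circ> ?S)"
      by (simp only: opscale_comp comp_opscale bop_pauli pauliB_anticommute)
  qed
  note b0 = anticommuting_involutions_mean[OF bop_pauli(2) pauliB_involution(2,1)
      bop_pauli(2) pauliB_involution(2,1) pauliB_anticommute, of 0, folded b0_def]
  note b1 = anticommuting_involutions_mean[OF bop_pauli(2) pauliB_involution(2,1) N, folded b1_def]
  have A: "pauliA 0 b \<in> algA {i. even i}" for b
    unfolding algA_def by (rule subsetD[OF cstar_gen_superset]) (auto simp: genA_def)
  have B: "pauliB 0 b \<in> algB {i. even i}" for b
    unfolding algB_def by (rule subsetD[OF cstar_gen_superset]) (auto simp: genB_def)
  have "b0 \<in> algB {i. even i}" "b1 \<in> algB {i. even i}"
    unfolding b0_def b1_def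
    by (intro cstar_opscale[OF algB_cstar] cstar_opadd[OF algB_cstar] B)+
  moreover have "hinner vac (pauliA 0 b (b0 vac)) = ?r" for b
  proof -
    have "pauliA 0 b (b0 vac) = vscale ?r (vadd (pauliA 0 b (?S vac)) (pauliA 0 b (?T vac)))"
      unfolding b0_def opscale_def opadd_def
      by (simp only: bop_scale[OF bop_pauli(1)] bop_add[OF bop_pauli(1)] l2_add bop_l2[OF bop_pauli(2)])
    then show ?thesis
      using pauli_correlation[of b True] pauli_correlation[of b False]
      by (simp only: hinner_delta) (cases b; simp)
  qed
  moreover have "hinner vac (pauliA 0 b (b1 vac)) = (if b then ?r else - ?r)" for b
  proof -
    have "pauliA 0 b (b1 vac) = vscale ?r (vadd (pauliA 0 b (?S vac)) (vscale (-1) (pauliA 0 b (?T vac))))"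
      unfolding b1_def opscale_def opadd_def
      by (simp only: bop_scale[OF bop_pauli(1)] bop_add[OF bop_pauli(1)] l2_add l2_scale
          bop_l2[OF bop_pauli(2)])
    then show ?thesis
      using pauli_correlation[of b True] pauli_correlation[of b False]
      by (simp only: hinner_delta) (cases b; simp)
  qed
  moreover have "?r + ?r + ?r - (- ?r) = complex_of_real (2 * sqrt 2)"
  proof -
    have "1 / sqrt 2 + 1 / sqrt 2 + 1 / sqrt 2 - (- (1 / sqrt 2)) = 2 * sqrt 2"
      by (simp add: field_simps)
    then show ?thesis by (simp only: of_real_add[symmetric] of_real_diff[symmetric] of_real_minus[symmetric])
  qed
  ultimately show ?thesis
    using A b0 b1 pauliA_involution(2) opnorm_unitary_le[OF unitary_pauli(1)]
    by (intro exI[of _ "pauliA 0 True"] exI[of _ "pauliA 0 False"] exI[of _ b0] exI[of _ b1]) simp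
qed

section \<open>The split into even and odd sites\<close>

lemma site_moves_simps [simp]: "site_shift \<in> site_moves" "site_swap \<in> site_moves"
  by (simp_all add: site_moves_def)

lemma even_odd_Un: "{i::nat. even i} \<union> {i. odd i} = UNIV" by auto

lemma even_odd_Int: "{i::nat. even i} \<inter> {i. odd i} = {}" by auto

lemma site_swap_even: "site_swap ` {i. even i} = {i. odd i}"
proof
  show "{i. odd i} \<subseteq> site_swap ` {i. even i}"
  proof
    fix i :: nat assume "i \<in> {i. odd i}"
    then show "i \<in> site_swap ` {i. even i}"
      by (intro image_eqI[of _ _ "site_swap i"]) (simp_all add: even_site_swap)
  qed
qed (auto simp: even_site_swap)

lemma algs_Un_even: "cstar_gen (algA I \<union> algB J) = cstar_gen (genA I \<union> genB J)"
  unfolding algA_def algB_def by (rule cstar_gen_Un_gen)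

text \<open>The first summand holds the final state; the second holds the final state after each
  even site has been exchanged with its odd neighbour. To the even sites both look like the initial
  state.\<close>

lemma even_state:
  assumes "X \<in> cstar_gen (genA {i. even i} \<union> genB {i. even i})"
  shows "hinner (delta (site_shift, site_shift, {})) (X (delta (site_shift, site_shift, {}))) = hinner vac (X vac)"
    and "hinner (delta (site_shift \<circ> site_swap, site_shift \<circ> site_swap, {}))
      (X (delta (site_shift \<circ> site_swap, site_shift \<circ> site_swap, {}))) = hinner vac (X vac)"
proof -
  \<comment> \<open>These values separate both permutations from the identity: the first sends 1 to
    4, the composite sends 0 to 4.\<close>
  have "site_shift 1 = 4" "site_swap 0 = 1" by (simp_all add: site_shift_def site_swap_def)
  then have ne: "site_shift \<noteq> id" "site_shift \<circ> site_swap \<noteq> id"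
    by (metis id_apply one_eq_numeral_iff semiring_norm(83), metis comp_apply id_apply zero_neq_numeral)
  have "id \<circ> site_shift \<in> site_perms" by (rule site_movesD(2)[OF _ id_site_perms]) simp
  then have u: "site_shift \<in> site_perms" by simp
  then have uw: "site_shift \<circ> site_swap \<in> site_perms" by (intro site_movesD(2)) simp_all
  show "hinner (delta (site_shift, site_shift, {})) (X (delta (site_shift, site_shift, {}))) = hinner vac (X vac)"
    by (rule sector_state[OF u ne(1) _ assms]) (simp add: dvd_site_shift)
  show "hinner (delta (site_shift \<circ> site_swap, site_shift \<circ> site_swap, {}))
      (X (delta (site_shift \<circ> site_swap, site_shift \<circ> site_swap, {}))) = hinner vac (X vac)"
    by (rule sector_state[OF uw ne(2) _ assms]) (simp add: dvd_site_shift_swap)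
qed

text \<open>Conjugating X and Y by their own unitaries equals conjugating the product by both: the
  adjoint of the B-unitary moves left past the A-unitary and X, and the A-unitary moves right past
  Y.\<close>

lemma conjop_product:
  assumes g: "g \<in> site_moves" and X: "X \<in> algA I" and Y: "Y \<in> algB J"
  shows "conjop (relabelA g) X \<circ> conjop (relabelB g) Y
    = adj (relabelA g) \<circ> adj (relabelB g) \<circ> (X \<circ> Y) \<circ> (relabelA g \<circ> relabelB g)"
proof -
  let ?U = "relabelA g" and ?V = "relabelB g"
  note U = unitary_relabel(1)[OF g] and V = unitary_relabel(2)[OF g]
  have 1: "?U \<circ> adj ?V = adj ?V \<circ> ?U"
    by (rule commute_with_unitary[OF V unitary_bop[OF U] relabelA_relabelB_commute[OF g g]])
  have 2: "X \<circ> adj ?V = adj ?V \<circ> X"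
    by (rule commute_with_unitary[OF V cstar_bop[OF algA_cstar X] algA_commute_relabelB[OF g X]])
  have 3: "Y \<circ> ?U = ?U \<circ> Y" by (rule algB_commute_relabelA[OF g Y])
  have "conjop ?U X \<circ> conjop ?V Y = adj ?U \<circ> X \<circ> (?U \<circ> adj ?V) \<circ> Y \<circ> ?V"
    by (simp only: conjop_def comp_assoc)
  also have "\<dots> = adj ?U \<circ> (X \<circ> adj ?V) \<circ> (?U \<circ> Y) \<circ> ?V" unfolding 1 by (simp only: comp_assoc)
  also have "\<dots> = adj ?U \<circ> adj ?V \<circ> (X \<circ> Y) \<circ> (?U \<circ> ?V)"
    unfolding 2 3[symmetric] by (simp only: comp_assoc)
  finally show ?thesis .
qed

theorem theorem1p2:
  shows "\<exists>A1 B1 A2 B2 \<psi> UA UB.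
    unital_cstar_subalg A1 \<and> unital_cstar_subalg B1 \<and>
    unital_cstar_subalg A2 \<and> unital_cstar_subalg B2 \<and>
    commute_algs A1 B1 \<and> commute_algs A1 A2 \<and> commute_algs A1 B2 \<and>
    commute_algs B1 A2 \<and> commute_algs B1 B2 \<and> commute_algs A2 B2 \<and>
    \<psi> \<in> l2 \<and> hnorm \<psi> = 1 \<and>
    unitary UA \<and> acts_on UA {B1, B2} {A1, A2} \<and>
    unitary UB \<and> acts_on UB {A1, A2} {B1, B2} \<and>
    UA \<circ> UB = UB \<circ> UA \<and>
    (let \<psi>' = UA (UB \<psi>) in
      (\<exists>a0 a1 b0 b1.
         a0 \<in> A1 \<and> a1 \<in> A1 \<and> b0 \<in> B1 \<and> b1 \<in> B1 \<and>
         adj a0 = a0 \<and> adj a1 = a1 \<and> adj b0 = b0 \<and> adj b1 = b1 \<and>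
         opnorm a0 \<le> 1 \<and> opnorm a1 \<le> 1 \<and> opnorm b0 \<le> 1 \<and> opnorm b1 \<le> 1 \<and>
         hinner \<psi> (a0 (b0 \<psi>)) + hinner \<psi> (a0 (b1 \<psi>)) + hinner \<psi> (a1 (b0 \<psi>))
           - hinner \<psi> (a1 (b1 \<psi>)) = complex_of_real (2 * sqrt 2)) \<and>
      (\<forall>X\<in>cstar_gen (A1 \<union> B1). \<forall>Y\<in>A2. \<forall>Z\<in>B2.
         hinner \<psi> (X (Y (Z \<psi>))) = hinner \<psi> (X \<psi>) * hinner \<psi> (Y \<psi>) * hinner \<psi> (Z \<psi>)) \<and>
      (\<forall>X\<in>cstar_gen (A1 \<union> B1). hinner \<psi> (X \<psi>) = hinner \<psi>' (X \<psi>')) \<and>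
      (\<exists>WA WB.
         unitary WA \<and> acts_on WA {B1, B2} {A1, A2} \<and>
         unitary WB \<and> acts_on WB {A1, A2} {B1, B2} \<and>
         conjop WA ` A1 = A2 \<and> conjop WB ` B1 = B2 \<and>
         (\<forall>X\<in>A1. \<forall>Y\<in>B1.
            hinner \<psi>' (X (Y \<psi>')) = hinner \<psi>' ((conjop WA X) ((conjop WB Y) \<psi>')))))"
proof -
  let ?ev = "{i::nat. even i}" and ?od = "{i::nat. odd i}"
  let ?A1 = "algA ?ev" and ?A2 = "algA ?od" and ?B1 = "algB ?ev" and ?B2 = "algB ?od"
  let ?UA = "relabelA site_shift" and ?UB = "relabelB site_shift"
  let ?WA = "relabelA site_swap" and ?WB = "relabelB site_swap"
  let ?\<psi>' = "delta (site_shift, site_shift, {})"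
  have \<psi>': "?UA (?UB vac) = ?\<psi>'"
    using relabel_delta[of site_shift id] id_site_perms by simp
  have u: "site_shift \<in> site_perms"
    using site_movesD(2)[of site_shift id] id_site_perms by simp
  have prod: "hinner vac (X (Y (Z vac))) = hinner vac (X vac) * hinner vac (Y vac) * hinner vac (Z vac)"
    if "X \<in> cstar_gen (?A1 \<union> ?B1)" "Y \<in> ?A2" "Z \<in> ?B2" for X Y Z
  proof -
    have Y: "Y \<in> cstar_gen (genA ?od \<union> genB {})" and Z: "Z \<in> cstar_gen (genA {} \<union> genB ?od)"
      using that(2,3) unfolding algA_def algB_def by (simp_all flip: gen_Un_empty)
    have YZ: "Y \<circ> Z \<in> cstar_gen (genA ?od \<union> genB ?od)"
      by (intro cstar_comp[OF cstar_gen_AB] subsetD[OF algs_sub(1) that(2)] subsetD[OF algs_sub(2) that(3)])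
    have X: "X \<in> cstar_gen (genA ?ev \<union> genB ?ev)" using that(1) unfolding algs_Un_even .
    \<comment> \<open>Two rounds of \<open>vac_product\<close>: parity separates the registers 1
      from the registers 2; then the slots (i, False) and (i, True) separate A from B, as 4 divides
      no odd i.\<close>
    have "hinner vac (X ((Y \<circ> Z) vac)) = hinner vac (X vac) * hinner vac ((Y \<circ> Z) vac)"
      by (rule vac_product[OF X YZ]) (auto simp: coords_def)
    moreover have "hinner vac (Y (Z vac)) = hinner vac (Y vac) * hinner vac (Z vac)"
      by (rule vac_product[OF Y Z]) (auto simp: coords_def)
    ultimately show ?thesis by (simp only: comp_apply mult.assoc)
  qed
  have inv: "hinner vac (X vac) = hinner ?\<psi>' (X ?\<psi>')" if "X \<in> cstar_gen (?A1 \<union> ?B1)" for X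
    using even_state(1)[of X] that unfolding algs_Un_even by simp
  have copy: "hinner ?\<psi>' (X (Y ?\<psi>')) = hinner ?\<psi>' ((conjop ?WA X) ((conjop ?WB Y) ?\<psi>'))"
    if X: "X \<in> ?A1" and Y: "Y \<in> ?B1" for X Y
  proof -
    have XY: "X \<circ> Y \<in> cstar_gen (genA ?ev \<union> genB ?ev)"
      by (intro cstar_comp[OF cstar_gen_AB] subsetD[OF algs_sub(1) X] subsetD[OF algs_sub(2) Y])
    then have bXY: "bop (X \<circ> Y)" by (rule cstar_bop[OF cstar_gen_AB])
    \<comment> \<open>The final state after the swap by both parties. Moving the swaps from the
      operators to the vectors turns the state of the odd sites into that of the even sites in
      \<open>?\<phi>\<close>, and \<open>even_state\<close> equates this with the initial state, as
      it does for \<open>?\<psi>'\<close>.\<close>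
    let ?\<phi> = "delta (site_shift \<circ> site_swap, site_shift \<circ> site_swap, {})"
    have \<phi>: "?WA (?WB ?\<psi>') = ?\<phi>" "?WB (?WA ?\<psi>') = ?\<phi>"
      using relabel_delta[of site_swap site_shift] u
        fun_cong[OF relabelA_relabelB_commute[of site_swap site_swap], of ?\<psi>'] by simp_all
    have WA: "bop ?WA" and WB: "bop ?WB" by (simp_all add: unitary_bop unitary_relabel)
    have "(conjop ?WA X) ((conjop ?WB Y) ?\<psi>') = adj ?WA (adj ?WB ((X \<circ> Y) ?\<phi>))"
      using fun_cong[OF conjop_product[OF _ X Y, of site_swap], of ?\<psi>'] \<phi>(1) by simp
    then have "hinner ?\<psi>' ((conjop ?WA X) ((conjop ?WB Y) ?\<psi>'))
        = hinner (?WB (?WA ?\<psi>')) ((X \<circ> Y) ?\<phi>)"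
      using WA WB bXY by (simp only: hinner_adj_right bop_l2 bop_adj delta_l2)
    also have "\<dots> = hinner ?\<psi>' ((X \<circ> Y) ?\<psi>')"
      unfolding \<phi>(2) even_state[OF XY] by (rule refl)
    finally show ?thesis by simp
  qed
  have comm: "commute_algs ?A1 ?B1" "commute_algs ?A1 ?A2" "commute_algs ?A1 ?B2"
    "commute_algs ?B1 ?A2" "commute_algs ?B1 ?B2" "commute_algs ?A2 ?B2"
    by (intro commute_algA_algB commute_algA_algA commute_algB_algB even_odd_Int
        commute_algs_sym[OF commute_algA_algB])+
  have acts: "acts_on (relabelA g) {?B1, ?B2} {?A1, ?A2}" "acts_on (relabelB g) {?A1, ?A2} {?B1, ?B2}"
    if "g \<in> site_moves" for g
    by (rule acts_on_relabelA[OF that even_odd_Un] acts_on_relabelB[OF that even_odd_Un])+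
  have swap: "conjop ?WA ` ?A1 = ?A2" "conjop ?WB ` ?B1 = ?B2"
    by (simp_all add: conjop_algA conjop_algB site_swap_even)
  show ?thesis
    unfolding Let_def
  proof (rule exI[of _ ?A1], rule exI[of _ ?B1], rule exI[of _ ?A2], rule exI[of _ ?B2],
      rule exI[of _ vac], rule exI[of _ ?UA], rule exI[of _ ?UB], unfold \<psi>')
  qed (intro conjI algA_cstar algB_cstar comm delta_l2 vac_norm unitary_relabel acts site_moves_simps
        relabelA_relabelB_commute CHSH_maximal ballI prod inv
        exI[of _ ?WA] exI[of _ ?WB] swap copy)
qed

end
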